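(* Let $\mathbb{F}$ be a field and let $B$ and $\widetilde{B}$ be two Blaschke products with strong Property $\mathfrak{B}$. If there is a path (continuous with respect to the supremum norm) connecting $B$ and $\widetilde{B}$ in the set of all inner functions with strong Property $\mathfrak{B}$, then the interleaving distance $d_{int}(\mathbb{B},\widetilde{\mathbb{B}})$ between the persistence modules induced by $B$ and $\widetilde{B}$ is finite.
   Context: $\mathbb{D}$ is the open unit disk. An inner function is a bounded analytic function on $\mathbb{D}$ with unimodular radial limits almost everywhere on $\partial\mathbb{D}$. A Blaschke product is an inner function $B(z)=\lambda z^m\prod_n\frac{|\alpha_n|}{\alpha_n}\frac{\alpha_n-z}{1-\overline{\alpha_n}z}$ with $|\lambda|=1$, $m\ge0$ an integer, $\{\alpha_n\}$ a finite or infinite sequence in $\mathbb{D}\setminus\{0\}$ with $\sum_n(1-|\alpha_n|)<\infty$. The supremum norm is $\|f\|_\infty=\sup_{z\in\mathbb{D}}|f(z)|$. For an inner function $u$ and $\theta\in(0,1)$ put $\Omega_{u,\theta}=\{z\in\mathbb{D}:|u(z)|<\theta\}$. Let $\rho(z_1,z_2)=\left|\frac{z_1-z_2}{1-\overline{z_1}z_2}\right|$ and $\delta_{u,\eta}=\sup\{\rho(z_1,z_2): z_1,z_2 \text{ belong to the same connected component of }\Omega_{u,\eta}\}$ (supremum in $[0,1]$). Property $\mathfrak{B}$: for every $\theta\in(0,1)$ the closure of each component of $\Omega_{u,\theta}$ is contained in $\mathbb{D}$. Strong Property $\mathfrak{B}$: $u$ has Property $\mathfrak{B}$ and there is $\eta\in(0,1)$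 with $\delta_{u,\eta}<1$. Persistence module (over $\mathbb{F}$): vector spaces $\{V_t\}_{t\in\mathbb{R}}$ with linear maps $\pi_{s,t}:V_s\to V_t$ ($s\le t$) satisfying $\pi_{s,r}=\pi_{t,r}\circ\pi_{s,t}$, $\pi_{t,t}=\mathrm{id}$, and $V_s=0$ for all sufficiently small $s$. Morphisms are families of linear maps commuting with the structure maps. The shift $\mathbb{V}[\Delta]$ has $(V[\Delta])_t=V_{t+\Delta}$, $(\pi[\Delta])_{s,t}=\pi_{s+\Delta,t+\Delta}$; for $\Delta>0$, $\Phi^{\Delta}_{\mathbb{V}}:\mathbb{V}\to\mathbb{V}[\Delta]$ is given by $\pi_{t,t+\Delta}$. $\mathbb{V},\mathbb{W}$ are $\Delta$-interleaved if there are morphisms $F:\mathbb{V}\to\mathbb{W}[\Delta]$, $G:\mathbb{W}\to\mathbb{V}[\Delta]$ with $G[\Delta]\circ F=\Phi^{2\Delta}_{\mathbb{V}}$ and $F[\Delta]\circ G=\Phi^{2\Delta}_{\mathbb{W}}$; $d_{int}(\mathbb{V},\mathbb{W})=\inf\{\Delta>0:\mathbb{V},\mathbb{W}\text{ are }\Delta\text{-interleaved}\}$ ($+\infty$ if there is no such $\Delta$). Persistence module induced by an inner function $u$: for $t>0$ let $\theta(t)=\frac{e^t-1}{e^t+1}$ and $\Sigma_{u,t}=\Omega_{u,\theta(t)}$; $V_t=H_0(\Sigma_{u,t};\mathbb{F})$ for $t>0$ (all higher homology vanishes), $V_t=0$ for $t\le0$, and $\pi_{s,t}$ is induced by the inclusion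 for $0<s\le t$. *)

theory Defs
  imports "HOL-Analysis.Analysis" "HOL-Homology.Homology"
begin

section \<open>Inner functions and Blaschke products\<close>

text \<open>A function on the unit disk is a total function on the complex plane of which only the
  values on \<open>ball 0 1\<close> matter.\<close>

definition inner_function :: "(complex \<Rightarrow> complex) \<Rightarrow> bool" where
  "inner_function u \<longleftrightarrow>
     u holomorphic_on ball 0 1 \<and> bounded (u ` ball 0 1) \<and>
     (AE t in lebesgue_on {0..2*pi}.
        \<exists>l. cmod l = 1 \<and> tendsto (\<lambda>r. u (of_real r * cis t)) l (at_left 1))"

definition blaschke_factor :: "complex \<Rightarrow> complex \<Rightarrow> complex" where
  "blaschke_factor \<alpha> z = (of_real (cmod \<alpha>) / \<alpha>) * ((\<alpha> - z) / (1 - cnj \<alpha> * z))"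

text \<open>The zeros away from the origin are \<open>\<alpha> n\<close> for \<open>n < N\<close>; the sequence is infinite
  iff \<open>N = \<infinity>\<close>.\<close>

definition blaschke_product :: "(complex \<Rightarrow> complex) \<Rightarrow> bool" where
  "blaschke_product B \<longleftrightarrow> inner_function B \<and>
     (\<exists>(c::complex) (m::nat) (N::enat) (\<alpha>::nat \<Rightarrow> complex).
        cmod c = 1 \<and>
        (\<forall>n. enat n < N \<longrightarrow> \<alpha> n \<in> ball 0 1 - {0}) \<and>
        summable (\<lambda>n. if enat n < N then 1 - cmod (\<alpha> n) else 0) \<and>
        (\<forall>z\<in>ball 0 1.
           B z = c * z ^ m * prodinf (\<lambda>n. if enat n < N then blaschke_factor (\<alpha> n) z else 1)))"

definition sup_norm :: "(complex \<Rightarrow> complex) \<Rightarrow> real" where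
  "sup_norm f = (SUP z\<in>ball 0 1. cmod (f z))"

definition joined_by_sup_norm_path ::
  "(complex \<Rightarrow> complex) set \<Rightarrow> (complex \<Rightarrow> complex) \<Rightarrow> (complex \<Rightarrow> complex) \<Rightarrow> bool" where
  "joined_by_sup_norm_path S f g \<longleftrightarrow>
     (\<exists>\<gamma> :: real \<Rightarrow> complex \<Rightarrow> complex.
        (\<forall>s\<in>{0..1}. \<gamma> s \<in> S) \<and>
        (\<forall>s\<in>{0..1}. tendsto (\<lambda>s'. sup_norm (\<lambda>z. \<gamma> s' z - \<gamma> s z)) 0 (at s within {0..1})) \<and>
        (\<forall>z\<in>ball 0 1. \<gamma> 0 z = f z) \<and> (\<forall>z\<in>ball 0 1. \<gamma> 1 z = g z))"

section \<open>Strong Property B\<close>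

definition sublevel :: "(complex \<Rightarrow> complex) \<Rightarrow> real \<Rightarrow> complex set" where
  "sublevel u \<theta> = {z \<in> ball 0 1. cmod (u z) < \<theta>}"

definition pseudo_hyperbolic :: "complex \<Rightarrow> complex \<Rightarrow> real" where
  "pseudo_hyperbolic z w = cmod ((z - w) / (1 - cnj z * w))"

text \<open>Inserting \<open>0\<close> makes the supremum one in \<open>[0,1]\<close>: it only matters when the
  sublevel set is empty.\<close>

definition component_diameter :: "(complex \<Rightarrow> complex) \<Rightarrow> real \<Rightarrow> real" where
  "component_diameter u \<eta> =
     Sup (insert 0 {pseudo_hyperbolic z w | z w C.
                      C \<in> components (sublevel u \<eta>) \<and> z \<in> C \<and> w \<in> C})"

definition property_B :: "(complex \<Rightarrow> complex) \<Rightarrow> bool" where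
  "property_B u \<longleftrightarrow>
     (\<forall>\<theta>. 0 < \<theta> \<and> \<theta> < 1 \<longrightarrow> (\<forall>C\<in>components (sublevel u \<theta>). closure C \<subseteq> ball 0 1))"

definition strong_property_B :: "(complex \<Rightarrow> complex) \<Rightarrow> bool" where
  "strong_property_B u \<longleftrightarrow>
     property_B u \<and> (\<exists>\<eta>. 0 < \<eta> \<and> \<eta> < 1 \<and> component_diameter u \<eta> < 1)"

section \<open>Vector spaces over a field\<close>

text \<open>A vector space over the field \<open>K\<close> is a \<^term>\<open>Module.module K V\<close>.  The ring fields
  \<open>mult\<close> and \<open>one\<close> of a module record carry no meaning.\<close>

definition linear_maps :: "'k ring \<Rightarrow> ('k, 'v) module \<Rightarrow> ('k, 'w) module \<Rightarrow> ('v \<Rightarrow> 'w) set" where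
  "linear_maps K V W =
     {f. f \<in> carrier V \<rightarrow> carrier W \<and>
         (\<forall>x\<in>carrier V. \<forall>y\<in>carrier V. f (x \<oplus>\<^bsub>V\<^esub> y) = f x \<oplus>\<^bsub>W\<^esub> f y) \<and>
         (\<forall>a\<in>carrier K. \<forall>x\<in>carrier V. f (a \<odot>\<^bsub>V\<^esub> x) = a \<odot>\<^bsub>W\<^esub> f x)}"

definition zero_space :: "('k, 'v) module" where
  "zero_space = \<lparr>carrier = {undefined}, monoid.mult = undefined, one = undefined,
     zero = undefined, add = (\<lambda>_ _. undefined), smult = (\<lambda>_ _. undefined)\<rparr>"

text \<open>The scalar multiple of a coset is a union, so that no representative has to be chosen and
  \<open>0\<close> times a coset is \<open>N\<close>.\<close>

definition quotient_space :: "('k, 'v) module \<Rightarrow> 'v set \<Rightarrow> ('k, 'v set) module" where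
  "quotient_space V N = \<lparr>carrier = a_rcosets\<^bsub>V\<^esub> N, monoid.mult = undefined, one = undefined,
     zero = N, add = set_add V, smult = (\<lambda>a A. \<Union>x\<in>A. N +>\<^bsub>V\<^esub> (a \<odot>\<^bsub>V\<^esub> x))\<rparr>"

section \<open>Singular homology with coefficients in a field\<close>

text \<open>The library provides singular chains with integer coefficients; here the chain complex is
  tensored with \<open>K\<close>.  A chain is a finitely supported function from singular simplices to \<open>K\<close>,
  and an additive map \<open>\<phi>\<close> between integral chains extends \<open>K\<close>-linearly.\<close>

type_synonym 'a sing_simplex = "(nat \<Rightarrow> real) \<Rightarrow> 'a"

definition chain_space :: "'k ring \<Rightarrow> nat \<Rightarrow> 'a topology \<Rightarrow> ('k, 'a sing_simplex \<Rightarrow> 'k) module" where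
  "chain_space K p X = \<lparr>
     carrier = {c. (\<forall>f. c f \<in> carrier K) \<and> finite {f. c f \<noteq> \<zero>\<^bsub>K\<^esub>} \<and>
                   {f. c f \<noteq> \<zero>\<^bsub>K\<^esub>} \<subseteq> singular_simplex_set p X},
     monoid.mult = undefined, one = undefined,
     zero = (\<lambda>f. \<zero>\<^bsub>K\<^esub>), add = (\<lambda>c d f. c f \<oplus>\<^bsub>K\<^esub> d f), smult = (\<lambda>a c f. a \<otimes>\<^bsub>K\<^esub> c f)\<rparr>"

definition extend_coefficients ::
  "'k ring \<Rightarrow> ('a chain \<Rightarrow> 'b chain) \<Rightarrow> ('a sing_simplex \<Rightarrow> 'k) \<Rightarrow> 'b sing_simplex \<Rightarrow> 'k" where
  "extend_coefficients K \<phi> c g =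
     (\<Oplus>\<^bsub>K\<^esub>f\<in>{f. c f \<noteq> \<zero>\<^bsub>K\<^esub>}. [poly_mapping.lookup (\<phi> (frag_of f)) g] \<cdot>\<^bsub>K\<^esub> c f)"

definition cycles :: "'k ring \<Rightarrow> nat \<Rightarrow> 'a topology \<Rightarrow> ('a sing_simplex \<Rightarrow> 'k) set" where
  "cycles K p X = {c \<in> carrier (chain_space K p X).
     extend_coefficients K (chain_boundary p) c = (\<lambda>f. \<zero>\<^bsub>K\<^esub>)}"

definition boundaries :: "'k ring \<Rightarrow> nat \<Rightarrow> 'a topology \<Rightarrow> ('a sing_simplex \<Rightarrow> 'k) set" where
  "boundaries K p X =
     extend_coefficients K (chain_boundary (Suc p)) ` carrier (chain_space K (Suc p) X)"

definition singular_homology ::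
  "'k ring \<Rightarrow> nat \<Rightarrow> 'a topology \<Rightarrow> ('k, ('a sing_simplex \<Rightarrow> 'k) set) module" where
  "singular_homology K p X =
     quotient_space (chain_space K p X\<lparr>carrier := cycles K p X\<rparr>) (boundaries K p X)"

text \<open>The map induced by \<open>g\<close> in homology, from any space into \<open>Y\<close>.\<close>

definition homology_map ::
  "'k ring \<Rightarrow> nat \<Rightarrow> 'b topology \<Rightarrow> ('a \<Rightarrow> 'b) \<Rightarrow> ('a sing_simplex \<Rightarrow> 'k) set \<Rightarrow> ('b sing_simplex \<Rightarrow> 'k) set" where
  "homology_map K p Y g A =
     (\<Union>c\<in>A. boundaries K p Y +>\<^bsub>chain_space K p Y\<^esub> extend_coefficients K (chain_map p g) c)"

section \<open>Persistence modules\<close>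

record ('k, 'v) pers_module =
  pspace :: "real \<Rightarrow> ('k, 'v) module"
  pmap :: "real \<Rightarrow> real \<Rightarrow> 'v \<Rightarrow> 'v"

definition persistence_module :: "'k ring \<Rightarrow> ('k, 'v) pers_module \<Rightarrow> bool" where
  "persistence_module K V \<longleftrightarrow>
     (\<forall>t. Module.module K (pspace V t)) \<and>
     (\<forall>s t. s \<le> t \<longrightarrow> pmap V s t \<in> linear_maps K (pspace V s) (pspace V t)) \<and>
     (\<forall>s t r. s \<le> t \<and> t \<le> r \<longrightarrow>
        (\<forall>x\<in>carrier (pspace V s). pmap V s r x = pmap V t r (pmap V s t x))) \<and>
     (\<forall>t. \<forall>x\<in>carrier (pspace V t). pmap V t t x = x) \<and>
     (\<exists>t\<^sub>0. \<forall>s\<le>t\<^sub>0. carrier (pspace V s) = {\<zero>\<^bsub>pspace V s\<^esub>})"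

definition pers_morphism ::
  "'k ring \<Rightarrow> ('k, 'v) pers_module \<Rightarrow> ('k, 'w) pers_module \<Rightarrow> (real \<Rightarrow> 'v \<Rightarrow> 'w) \<Rightarrow> bool" where
  "pers_morphism K V W f \<longleftrightarrow>
     (\<forall>t. f t \<in> linear_maps K (pspace V t) (pspace W t)) \<and>
     (\<forall>s t. s \<le> t \<longrightarrow> (\<forall>x\<in>carrier (pspace V s). f t (pmap V s t x) = pmap W s t (f s x)))"

definition pers_shift :: "('k, 'v) pers_module \<Rightarrow> real \<Rightarrow> ('k, 'v) pers_module" where
  "pers_shift V \<Delta> = \<lparr>pspace = (\<lambda>t. pspace V (t + \<Delta>)), pmap = (\<lambda>s t. pmap V (s + \<Delta>) (t + \<Delta>))\<rparr>"

definition morphism_shift :: "(real \<Rightarrow> 'v \<Rightarrow> 'w) \<Rightarrow> real \<Rightarrow> real \<Rightarrow> 'v \<Rightarrow> 'w" where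
  "morphism_shift f \<Delta> = (\<lambda>t. f (t + \<Delta>))"

definition shift_morphism :: "('k, 'v) pers_module \<Rightarrow> real \<Rightarrow> real \<Rightarrow> 'v \<Rightarrow> 'v" where
  "shift_morphism V \<Delta> = (\<lambda>t. pmap V t (t + \<Delta>))"

definition interleaved ::
  "'k ring \<Rightarrow> real \<Rightarrow> ('k, 'v) pers_module \<Rightarrow> ('k, 'w) pers_module \<Rightarrow> bool" where
  "interleaved K \<Delta> V W \<longleftrightarrow>
     (\<exists>f g. pers_morphism K V (pers_shift W \<Delta>) f \<and> pers_morphism K W (pers_shift V \<Delta>) g \<and>
        (\<forall>t. \<forall>x\<in>carrier (pspace V t).
           morphism_shift g \<Delta> t (f t x) = shift_morphism V (2 * \<Delta>) t x) \<and>
        (\<forall>t. \<forall>y\<in>carrier (pspace W t).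
           morphism_shift f \<Delta> t (g t y) = shift_morphism W (2 * \<Delta>) t y))"

definition interleaving_distance ::
  "'k ring \<Rightarrow> ('k, 'v) pers_module \<Rightarrow> ('k, 'w) pers_module \<Rightarrow> ennreal" where
  "interleaving_distance K V W = Inf (ennreal ` {\<Delta>. 0 < \<Delta> \<and> interleaved K \<Delta> V W})"

section \<open>The persistence module induced by an inner function\<close>

definition level_param :: "real \<Rightarrow> real" where
  "level_param t = (exp t - 1) / (exp t + 1)"

definition level_space :: "(complex \<Rightarrow> complex) \<Rightarrow> real \<Rightarrow> complex topology" where
  "level_space u t = top_of_set (sublevel u (level_param t))"

definition induced_pspace ::
  "'k ring \<Rightarrow> (complex \<Rightarrow> complex) \<Rightarrow> real \<Rightarrow> ('k, (complex sing_simplex \<Rightarrow> 'k) set) module" where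
  "induced_pspace K u t =
     (if 0 < t then singular_homology K 0 (level_space u t) else zero_space)"

definition induced_module ::
  "'k ring \<Rightarrow> (complex \<Rightarrow> complex) \<Rightarrow> ('k, (complex sing_simplex \<Rightarrow> 'k) set) pers_module" where
  "induced_module K u = \<lparr>pspace = induced_pspace K u,
     pmap = (\<lambda>s t. if 0 < s then homology_map K 0 (level_space u t) id
                   else (\<lambda>_. \<zero>\<^bsub>induced_pspace K u t\<^esub>))\<rparr>"

section \<open>The induced module is a persistence module\<close>

lemma module_chain_space:
  assumes "cring K"
  shows "Module.module K (chain_space K p X)"
proof -
  interpret cring K by fact
  have fin: "finite {f. c f \<oplus>\<^bsub>K\<^esub> d f \<noteq> \<zero>\<^bsub>K\<^esub>}"
    if "finite {f. c f \<noteq> \<zero>\<^bsub>K\<^esub>}" "finite {f. d f \<noteq> \<zero>\<^bsub>K\<^esub>}" for c d :: "'b sing_simplex \<Rightarrow> 'a"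
    by (rule finite_subset [OF _ finite_UnI [OF that]]) auto
  have fin2: "finite {f. a \<otimes>\<^bsub>K\<^esub> c f \<noteq> \<zero>\<^bsub>K\<^esub>}"
    if "finite {f. c f \<noteq> \<zero>\<^bsub>K\<^esub>}" "a \<in> carrier K" for a and c :: "'b sing_simplex \<Rightarrow> 'a"
    by (rule finite_subset [OF _ that(1)]) (use that in auto)
  have ab: "abelian_group (chain_space K p X)"
  proof (rule abelian_groupI)
    fix x y
    assume "x \<in> carrier (chain_space K p X)" "y \<in> carrier (chain_space K p X)"
    then show "x \<oplus>\<^bsub>chain_space K p X\<^esub> y \<in> carrier (chain_space K p X)"
      using fin [of x y] unfolding chain_space_def by (simp add: subset_iff) (metis r_zero zero_closed)
  next
    fix x
    assume x: "x \<in> carrier (chain_space K p X)"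
    have *: "{f. \<ominus>\<^bsub>K\<^esub> x f \<noteq> \<zero>\<^bsub>K\<^esub>} \<subseteq> {f. x f \<noteq> \<zero>\<^bsub>K\<^esub>}" by auto
    show "\<exists>y\<in>carrier (chain_space K p X). y \<oplus>\<^bsub>chain_space K p X\<^esub> x = \<zero>\<^bsub>chain_space K p X\<^esub>"
      by (rule bexI [of _ "\<lambda>f. \<ominus>\<^bsub>K\<^esub> x f"])
        (use x * in \<open>auto simp: chain_space_def l_neg intro: finite_subset [OF *]\<close>)
  qed (auto simp: chain_space_def fun_eq_iff a_ac)
  show ?thesis
  proof (rule moduleI [OF assms ab])
    fix a x assume "a \<in> carrier K" "x \<in> carrier (chain_space K p X)"
    then show "a \<odot>\<^bsub>chain_space K p X\<^esub> x \<in> carrier (chain_space K p X)"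
      using fin2 [of x a] unfolding chain_space_def by (simp add: subset_iff) (metis r_null)
  qed (auto simp: chain_space_def fun_eq_iff l_distr r_distr m_assoc)
qed

lemma extend_coefficients_superset:
  assumes "cring K" "\<And>f. c f \<in> carrier K" "finite S" "{f. c f \<noteq> \<zero>\<^bsub>K\<^esub>} \<subseteq> S"
  shows "extend_coefficients K \<phi> c g =
     (\<Oplus>\<^bsub>K\<^esub>f\<in>S. [poly_mapping.lookup (\<phi> (frag_of f)) g] \<cdot>\<^bsub>K\<^esub> c f)"
proof -
  interpret cring K by fact
  show ?thesis
    unfolding extend_coefficients_def
    by (rule add.finprod_mono_neutral_cong_left) (use assms in \<open>auto simp: Pi_def\<close>)
qed

lemma extend_coefficients_linear:
  assumes "cring K" "c \<in> carrier (chain_space K p X)" "d \<in> carrier (chain_space K p X)" "a \<in> carrier K"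
  shows "extend_coefficients K \<phi> c g \<in> carrier K"
    and "extend_coefficients K \<phi> (c \<oplus>\<^bsub>chain_space K p X\<^esub> d) =
         extend_coefficients K \<phi> c \<oplus>\<^bsub>chain_space K q Y\<^esub> extend_coefficients K \<phi> d"
    and "extend_coefficients K \<phi> (a \<odot>\<^bsub>chain_space K p X\<^esub> c) =
         a \<odot>\<^bsub>chain_space K q Y\<^esub> extend_coefficients K \<phi> c"
proof -
  interpret cring K by fact
  interpret M: Module.module K "chain_space K p X" by (rule module_chain_space) fact
  define S where "S = {f. c f \<noteq> \<zero>\<^bsub>K\<^esub>} \<union> {f. d f \<noteq> \<zero>\<^bsub>K\<^esub>}"
  have S: "finite S" "\<And>f. c f \<in> carrier K" "\<And>f. d f \<in> carrier K"
    using assms by (auto simp: S_def chain_space_def)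
  show "extend_coefficients K \<phi> c g \<in> carrier K"
    unfolding extend_coefficients_def by (rule finsum_closed) (use S in \<open>auto simp: Pi_def\<close>)
  have c: "extend_coefficients K \<phi> c g =
     (\<Oplus>\<^bsub>K\<^esub>f\<in>S. [poly_mapping.lookup (\<phi> (frag_of f)) g] \<cdot>\<^bsub>K\<^esub> c f)" for g
    by (rule extend_coefficients_superset) (use S S_def assms in auto)
  have d: "extend_coefficients K \<phi> d g =
     (\<Oplus>\<^bsub>K\<^esub>f\<in>S. [poly_mapping.lookup (\<phi> (frag_of f)) g] \<cdot>\<^bsub>K\<^esub> d f)" for g
    by (rule extend_coefficients_superset) (use S S_def assms in auto)
  have s: "extend_coefficients K \<phi> (c \<oplus>\<^bsub>chain_space K p X\<^esub> d) g =
     (\<Oplus>\<^bsub>K\<^esub>f\<in>S. [poly_mapping.lookup (\<phi> (frag_of f)) g] \<cdot>\<^bsub>K\<^esub> (c f \<oplus>\<^bsub>K\<^esub> d f))" for g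
    by (subst extend_coefficients_superset [of _ _ S]) (use S S_def assms in \<open>auto simp: chain_space_def\<close>)
  have m: "extend_coefficients K \<phi> (a \<odot>\<^bsub>chain_space K p X\<^esub> c) g =
     (\<Oplus>\<^bsub>K\<^esub>f\<in>S. [poly_mapping.lookup (\<phi> (frag_of f)) g] \<cdot>\<^bsub>K\<^esub> (a \<otimes>\<^bsub>K\<^esub> c f))" for g
    by (subst extend_coefficients_superset [of _ _ S]) (use S S_def assms in \<open>auto simp: chain_space_def\<close>)
  show "extend_coefficients K \<phi> (c \<oplus>\<^bsub>chain_space K p X\<^esub> d) =
         extend_coefficients K \<phi> c \<oplus>\<^bsub>chain_space K q Y\<^esub> extend_coefficients K \<phi> d"
    unfolding fun_eq_iff s
    apply (simp add: chain_space_def c d)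
    apply (intro allI)
    apply (subst finsum_addf [symmetric])
    using S apply (auto simp: Pi_def add.int_pow_distrib)
    done
  show "extend_coefficients K \<phi> (a \<odot>\<^bsub>chain_space K p X\<^esub> c) =
         a \<odot>\<^bsub>chain_space K q Y\<^esub> extend_coefficients K \<phi> c"
    unfolding fun_eq_iff m
    apply (simp add: chain_space_def c)
    apply (intro allI)
    apply (subst finsum_rdistr)
    using S assms apply (auto simp: Pi_def add_pow_rdistr_int)
    done
qed

lemma extend_coefficients_closed:
  assumes "cring K" "c \<in> carrier (chain_space K p X)"
    and "\<And>f. singular_simplex p X f \<Longrightarrow> singular_chain q Y (\<phi> (frag_of f))"
  shows "extend_coefficients K \<phi> c \<in> carrier (chain_space K q Y)"
proof -
  interpret cring K by fact
  have z: "\<zero>\<^bsub>K\<^esub> \<in> carrier K" by simp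
  let ?S = "{f. c f \<noteq> \<zero>\<^bsub>K\<^esub>}"
  have S: "finite ?S" "\<And>f. f \<in> ?S \<Longrightarrow> singular_simplex p X f" "\<And>f. c f \<in> carrier K"
    using assms by (auto simp: chain_space_def)
  have "{g. extend_coefficients K \<phi> c g \<noteq> \<zero>\<^bsub>K\<^esub>} \<subseteq> (\<Union>f\<in>?S. Poly_Mapping.keys (\<phi> (frag_of f)))"
  proof clarify
    fix g assume "extend_coefficients K \<phi> c g \<noteq> \<zero>\<^bsub>K\<^esub>"
    then have "\<exists>f\<in>?S. [poly_mapping.lookup (\<phi> (frag_of f)) g] \<cdot>\<^bsub>K\<^esub> c f \<noteq> \<zero>\<^bsub>K\<^esub>"
      unfolding extend_coefficients_def using add.finprod_one_eqI by meson
    then obtain f where f: "f \<in> ?S" "[poly_mapping.lookup (\<phi> (frag_of f)) g] \<cdot>\<^bsub>K\<^esub> c f \<noteq> \<zero>\<^bsub>K\<^esub>"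
      by blast
    then have "poly_mapping.lookup (\<phi> (frag_of f)) g \<noteq> 0"
      by (auto simp: add_pow_def int_pow_def)
    then show "g \<in> (\<Union>f\<in>?S. Poly_Mapping.keys (\<phi> (frag_of f)))"
      using f(1) by (auto simp: in_keys_iff)
  qed
  moreover have "finite (\<Union>f\<in>?S. Poly_Mapping.keys (\<phi> (frag_of f)))" using S by auto
  moreover have "(\<Union>f\<in>?S. Poly_Mapping.keys (\<phi> (frag_of f))) \<subseteq> singular_simplex_set q Y"
    using assms(3) S(2) unfolding singular_chain_def by blast
  ultimately have "finite {g. extend_coefficients K \<phi> c g \<noteq> \<zero>\<^bsub>K\<^esub>}"
    "{g. extend_coefficients K \<phi> c g \<noteq> \<zero>\<^bsub>K\<^esub>} \<subseteq> singular_simplex_set q Y"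
    by (meson finite_subset, blast)
  moreover have "extend_coefficients K \<phi> c g \<in> carrier K" for g
    by (rule extend_coefficients_linear(1) [OF assms(1,2,2) z])
  ultimately show ?thesis
    unfolding chain_space_def by simp
qed

lemma submodule_boundaries:
  assumes "cring K"
  shows "submodule (boundaries K p X) K (chain_space K p X)"
proof -
  interpret cring K by fact
  interpret M: Module.module K "chain_space K p X" by (rule module_chain_space) fact
  interpret N: Module.module K "chain_space K (Suc p) X" by (rule module_chain_space) fact
  let ?d = "extend_coefficients K (chain_boundary (Suc p)) :: ('b sing_simplex \<Rightarrow> 'a) \<Rightarrow> _"
  note lin2 = extend_coefficients_linear(2) [OF assms, where p = "Suc p" and X = X and q = p and Y = X]
  note lin3 = extend_coefficients_linear(3) [OF assms, where p = "Suc p" and X = X and q = p and Y = X]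
  have cl: "?d c \<in> carrier (chain_space K p X)" if "c \<in> carrier (chain_space K (Suc p) X)" for c
    by (rule extend_coefficients_closed [OF assms that])
      (use singular_chain_boundary [of "Suc p" X] in \<open>auto simp: singular_chain_of\<close>)
  show ?thesis
  proof (rule M.submoduleI)
    show "boundaries K p X \<subseteq> carrier (chain_space K p X)"
      using cl by (auto simp: boundaries_def)
    have *: "a \<odot>\<^bsub>chain_space K p X\<^esub> x \<in> boundaries K p X" if "a \<in> carrier K" "x \<in> boundaries K p X" for a x
      using that lin3 [OF _ N.M.zero_closed] unfolding boundaries_def by (auto simp: image_iff) (metis N.smult_closed)
    then show "\<And>a x. a \<in> carrier K \<Longrightarrow> x \<in> boundaries K p X \<Longrightarrow> a \<odot>\<^bsub>chain_space K p X\<^esub> x \<in> boundaries K p X" .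
    have "?d \<zero>\<^bsub>chain_space K (Suc p) X\<^esub> \<in> boundaries K p X" by (auto simp: boundaries_def)
    from * [OF zero_closed this] show "\<zero>\<^bsub>chain_space K p X\<^esub> \<in> boundaries K p X"
      using cl by simp
    show "\<ominus>\<^bsub>chain_space K p X\<^esub> x \<in> boundaries K p X" if "x \<in> boundaries K p X" for x
    proof -
      have "x \<in> carrier (chain_space K p X)" using that cl by (auto simp: boundaries_def)
      then have "\<ominus>\<^bsub>chain_space K p X\<^esub> x = (\<ominus>\<^bsub>K\<^esub> \<one>\<^bsub>K\<^esub>) \<odot>\<^bsub>chain_space K p X\<^esub> x"
        by (simp add: M.smult_l_minus)
      then show ?thesis using * [of "\<ominus>\<^bsub>K\<^esub> \<one>\<^bsub>K\<^esub>" x] that by simp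
    qed
    show "x \<oplus>\<^bsub>chain_space K p X\<^esub> y \<in> boundaries K p X"
      if "x \<in> boundaries K p X" "y \<in> boundaries K p X" for x y
    proof -
      obtain c d where "x = ?d c" "y = ?d d" "c \<in> carrier (chain_space K (Suc p) X)" "d \<in> carrier (chain_space K (Suc p) X)"
        using \<open>x \<in> _\<close> \<open>y \<in> _\<close> unfolding boundaries_def by blast
      then show ?thesis using lin2 [of c d "\<zero>\<^bsub>K\<^esub>"] unfolding boundaries_def
        by (metis N.add.m_closed image_eqI zero_closed)
    qed
  qed
qed

lemma boundaries_mono:
  assumes "S \<subseteq> T" shows "boundaries K p (top_of_set S) \<subseteq> boundaries K p (top_of_set T)"
proof -
  have "singular_simplex_set q (top_of_set S) \<subseteq> singular_simplex_set q (top_of_set T)" for q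
    using assms by (fastforce simp: singular_simplex_def continuous_map_in_subtopology)
  then show ?thesis unfolding boundaries_def chain_space_def by (intro image_mono) auto
qed

lemma chain_space_mono:
  assumes "S \<subseteq> T" shows "carrier (chain_space K p (top_of_set S)) \<subseteq> carrier (chain_space K p (top_of_set T))"
proof -
  have "singular_simplex_set q (top_of_set S) \<subseteq> singular_simplex_set q (top_of_set T)" for q
    using assms by (fastforce simp: singular_simplex_def continuous_map_in_subtopology)
  then show ?thesis unfolding chain_space_def by auto
qed

lemma cycles_0: "cring K \<Longrightarrow> cycles K 0 X = carrier (chain_space K 0 X)"
proof -
  assume "cring K"
  then interpret cring K .
  show ?thesis unfolding cycles_def extend_coefficients_def chain_boundary_def
    by (auto simp: fun_eq_iff add_pow_def int_pow_def intro!: add.finprod_one_eqI)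
qed

lemma module_quotient_space:
  assumes "Module.module K V" "submodule N K V"
  shows "Module.module K (quotient_space V N)"
    and "\<And>x. x \<in> carrier V \<Longrightarrow> N +>\<^bsub>V\<^esub> x \<in> carrier (quotient_space V N)"
    and "\<And>x y. x \<in> carrier V \<Longrightarrow> y \<in> carrier V \<Longrightarrow>
       (N +>\<^bsub>V\<^esub> x) \<oplus>\<^bsub>quotient_space V N\<^esub> (N +>\<^bsub>V\<^esub> y) = N +>\<^bsub>V\<^esub> (x \<oplus>\<^bsub>V\<^esub> y)"
    and "\<And>a x. a \<in> carrier K \<Longrightarrow> x \<in> carrier V \<Longrightarrow>
       a \<odot>\<^bsub>quotient_space V N\<^esub> (N +>\<^bsub>V\<^esub> x) = N +>\<^bsub>V\<^esub> (a \<odot>\<^bsub>V\<^esub> x)"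
proof -
  interpret V: Module.module K V by fact
  interpret submodule N K V by fact
  interpret A: abelian_subgroup N V
    by (rule abelian_subgroupI2 [OF V.a_comm_group]) (rule subgroup_axioms)
  let ?Q = "quotient_space V N"
  have car: "carrier ?Q = (\<lambda>x. N +>\<^bsub>V\<^esub> x) ` carrier V"
    by (auto simp: quotient_space_def A_RCOSETS_def')
  show cl: "N +>\<^bsub>V\<^esub> x \<in> carrier ?Q" if "x \<in> carrier V" for x
    using that car by auto
  show add: "(N +>\<^bsub>V\<^esub> x) \<oplus>\<^bsub>?Q\<^esub> (N +>\<^bsub>V\<^esub> y) = N +>\<^bsub>V\<^esub> (x \<oplus>\<^bsub>V\<^esub> y)"
    if "x \<in> carrier V" "y \<in> carrier V" for x y
    using A.a_rcos_sum [OF that] by (simp add: quotient_space_def)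
  have sub: "N \<subseteq> carrier V" using A.a_subset .
  show smult: "a \<odot>\<^bsub>?Q\<^esub> (N +>\<^bsub>V\<^esub> x) = N +>\<^bsub>V\<^esub> (a \<odot>\<^bsub>V\<^esub> x)"
    if a: "a \<in> carrier K" and x: "x \<in> carrier V" for a x
  proof -
    have "N +>\<^bsub>V\<^esub> (a \<odot>\<^bsub>V\<^esub> y) = N +>\<^bsub>V\<^esub> (a \<odot>\<^bsub>V\<^esub> x)" if y: "y \<in> N +>\<^bsub>V\<^esub> x" for y
    proof -
      obtain n where n: "n \<in> N" "y = n \<oplus>\<^bsub>V\<^esub> x" using y by (auto simp: a_r_coset_def')
      then have "a \<odot>\<^bsub>V\<^esub> y = a \<odot>\<^bsub>V\<^esub> n \<oplus>\<^bsub>V\<^esub> a \<odot>\<^bsub>V\<^esub> x" using a x sub by (auto simp: V.smult_r_distr)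
      moreover have "a \<odot>\<^bsub>V\<^esub> n \<in> N" using a n by simp
      ultimately have "a \<odot>\<^bsub>V\<^esub> y \<in> N +>\<^bsub>V\<^esub> (a \<odot>\<^bsub>V\<^esub> x)" by (auto simp: a_r_coset_def')
      then show ?thesis
        using V.M.a_repr_independence [of "a \<odot>\<^bsub>V\<^esub> y" N "a \<odot>\<^bsub>V\<^esub> x"] a x A.a_subgroup by auto
    qed
    moreover have "x \<in> N +>\<^bsub>V\<^esub> x" by (rule A.a_rcos_self [OF x])
    ultimately have "(\<Union>y\<in>N +>\<^bsub>V\<^esub> x. N +>\<^bsub>V\<^esub> (a \<odot>\<^bsub>V\<^esub> y)) = N +>\<^bsub>V\<^esub> (a \<odot>\<^bsub>V\<^esub> x)"
      by (intro SUP_eq_const) blast+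
    then show ?thesis by (simp add: quotient_space_def)
  qed
  have zero: "\<zero>\<^bsub>?Q\<^esub> = N +>\<^bsub>V\<^esub> \<zero>\<^bsub>V\<^esub>"
    using sub by (simp add: quotient_space_def)
  show "Module.module K ?Q"
  proof (rule moduleI [OF V.R.is_cring abelian_groupI])
    show "\<And>x. x \<in> carrier ?Q \<Longrightarrow> \<exists>y\<in>carrier ?Q. y \<oplus>\<^bsub>?Q\<^esub> x = \<zero>\<^bsub>?Q\<^esub>"
      by (auto simp: car add zero) (metis V.M.add.inv_closed V.M.l_neg)
  qed (auto simp: car add zero smult V.M.a_ac V.smult_l_distr V.smult_r_distr V.smult_assoc1)
qed

lemma extend_coefficients_id:
  assumes "cring K" "c \<in> carrier (chain_space K p X)"
  shows "extend_coefficients K (chain_map p id) c = c"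
proof
  fix g
  interpret cring K by fact
  let ?S = "{f. c f \<noteq> \<zero>\<^bsub>K\<^esub>}"
  have S: "finite ?S" "\<And>f. f \<in> ?S \<Longrightarrow> singular_simplex p X f" "\<And>f. c f \<in> carrier K"
    using assms by (auto simp: chain_space_def)
  have zp: "[(0::int)] \<cdot>\<^bsub>K\<^esub> x = \<zero>\<^bsub>K\<^esub>" for x by (auto simp: add_pow_def int_pow_def)
  have "chain_map p id (frag_of f) = frag_of f" if "f \<in> ?S" for f
    using S(2) [OF that] by (auto simp: chain_map_of simplex_map_def singular_simplex_def extensional_restrict)
  then have "extend_coefficients K (chain_map p id) c g = (\<Oplus>\<^bsub>K\<^esub>f\<in>?S. if g = f then c f else \<zero>\<^bsub>K\<^esub>)"
    unfolding extend_coefficients_def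
    by (intro finsum_cong') (use S in \<open>auto simp: lookup_single Pi_def when_def add.int_pow_1 zp\<close>)
  also have "\<dots> = c g"
  proof (cases "g \<in> ?S")
    case True
    then show ?thesis using S add.finprod_singleton [of g ?S c] by (auto simp: Pi_def)
  next
    case False
    then show ?thesis by (auto intro!: add.finprod_one_eqI)
  qed
  finally show "extend_coefficients K (chain_map p id) c g = c g" .
qed

lemma homology_map_coset:
  assumes "cring K" "S \<subseteq> T" "c \<in> carrier (chain_space K 0 (top_of_set S))"
  shows "homology_map K 0 (top_of_set T) id
      (boundaries K 0 (top_of_set S) +>\<^bsub>chain_space K 0 (top_of_set S)\<^esub> c) =
    boundaries K 0 (top_of_set T) +>\<^bsub>chain_space K 0 (top_of_set T)\<^esub> c"
proof -
  let ?V = "chain_space K 0 (top_of_set S)" and ?W = "chain_space K 0 (top_of_set T)"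
  let ?N = "boundaries K 0 (top_of_set S)" and ?N' = "boundaries K 0 (top_of_set T)"
  interpret V: Module.module K ?V by (rule module_chain_space) fact
  interpret N: submodule ?N K ?V by (rule submodule_boundaries) fact
  interpret W: Module.module K ?W by (rule module_chain_space) fact
  interpret N': submodule ?N' K ?W by (rule submodule_boundaries) fact
  interpret A: abelian_subgroup ?N ?V
    by (rule abelian_subgroupI2 [OF V.a_comm_group]) (rule N.subgroup_axioms)
  interpret A': abelian_subgroup ?N' ?W
    by (rule abelian_subgroupI2 [OF W.a_comm_group]) (rule N'.subgroup_axioms)
  have c: "c \<in> carrier ?W" using assms chain_space_mono by blast
  have "?N' +>\<^bsub>?W\<^esub> extend_coefficients K (chain_map 0 id) d = ?N' +>\<^bsub>?W\<^esub> c"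
    if "d \<in> ?N +>\<^bsub>?V\<^esub> c" for d
  proof -
    have "d \<in> carrier ?V" using that V.M.a_r_coset_subset_G [OF A.a_subset assms(3)] by auto
    then have e: "extend_coefficients K (chain_map 0 id) d = d"
      by (rule extend_coefficients_id [OF assms(1)])
    have "d \<in> ?N' +>\<^bsub>?W\<^esub> c"
      using that boundaries_mono [OF assms(2), of K 0] by (auto simp: a_r_coset_def' chain_space_def)
    then show ?thesis
      using W.M.a_repr_independence [of d ?N' c] c A'.a_subgroup unfolding e by auto
  qed
  moreover have "c \<in> ?N +>\<^bsub>?V\<^esub> c" by (rule A.a_rcos_self) fact
  ultimately show ?thesis unfolding homology_map_def by (intro SUP_eq_const) blast+
qed

lemma sublevel_param_mono: "s \<le> t \<Longrightarrow> sublevel u (level_param s) \<subseteq> sublevel u (level_param t)"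
proof -
  assume "s \<le> t"
  then have "level_param s \<le> level_param t"
  proof -
    have *: "level_param x = 1 - 2 / (exp x + 1)" for x
    proof -
      have "exp x + 1 \<noteq> 0" by (metis add_pos_pos exp_gt_zero less_irrefl zero_less_one)
      then show ?thesis by (simp add: level_param_def field_simps)
    qed
    show ?thesis unfolding * using \<open>s \<le> t\<close> by (auto intro!: divide_left_mono mult_pos_pos add_pos_pos)
  qed
  then show ?thesis by (auto simp: sublevel_def)
qed

lemma persistence_module_induced_module:
  assumes "Ring.field K"
  shows "persistence_module K (induced_module K u)"
proof -
  have K: "cring K" using assms by (simp add: Ring.field_def domain_def)
  interpret cring K by fact
  let ?X = "level_space u"
  let ?V = "\<lambda>t. chain_space K 0 (?X t)" and ?N = "\<lambda>t. boundaries K 0 (?X t)"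
  have H: "singular_homology K 0 X = quotient_space (chain_space K 0 X) (boundaries K 0 X)"
    for X :: "complex topology"
    unfolding singular_homology_def cycles_0 [OF K] by simp
  note quot = module_quotient_space [OF module_chain_space [OF K] submodule_boundaries [OF K]]
  have Qmod: "Module.module K (singular_homology K 0 (?X t))" for t
    unfolding H by (rule quot(1))
  have Qadd: "(?N t +>\<^bsub>?V t\<^esub> x) \<oplus>\<^bsub>singular_homology K 0 (?X t)\<^esub> (?N t +>\<^bsub>?V t\<^esub> y) =
      ?N t +>\<^bsub>?V t\<^esub> (x \<oplus>\<^bsub>?V t\<^esub> y)"
    if "x \<in> carrier (?V t)" "y \<in> carrier (?V t)" for x y t
    unfolding H by (rule quot(3)) fact+
  have Qsmult: "a \<odot>\<^bsub>singular_homology K 0 (?X t)\<^esub> (?N t +>\<^bsub>?V t\<^esub> x) = ?N t +>\<^bsub>?V t\<^esub> (a \<odot>\<^bsub>?V t\<^esub> x)"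
    if "a \<in> carrier K" "x \<in> carrier (?V t)" for a x t
    unfolding H by (rule quot(4)) fact+
  have car: "carrier (singular_homology K 0 (?X t)) = (\<lambda>x. ?N t +>\<^bsub>?V t\<^esub> x) ` carrier (?V t)" for t
    by (auto simp: H quotient_space_def A_RCOSETS_def')
  have sub: "carrier (?V s) \<subseteq> carrier (?V t)" if "s \<le> t" for s t
    unfolding level_space_def by (intro chain_space_mono sublevel_param_mono that)
  have hm: "homology_map K 0 (?X t) id (?N s +>\<^bsub>?V s\<^esub> c) = ?N t +>\<^bsub>?V t\<^esub> c"
    if "s \<le> t" "c \<in> carrier (?V s)" for s t c
    using that homology_map_coset [OF K sublevel_param_mono [OF that(1)]] unfolding level_space_def by blast
  have ops: "c \<oplus>\<^bsub>?V s\<^esub> d = c \<oplus>\<^bsub>?V t\<^esub> d" "a \<odot>\<^bsub>?V s\<^esub> c = a \<odot>\<^bsub>?V t\<^esub> c" for s t c d a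
    by (simp_all add: chain_space_def)
  have zs: "Module.module K (zero_space :: ('a, (complex sing_simplex \<Rightarrow> 'a) set) module)"
    by (rule moduleI [OF K abelian_groupI]) (auto simp: zero_space_def)
  have mod: "Module.module K (induced_pspace K u t)" for t
    unfolding induced_pspace_def using Qmod zs by simp
  have ind: "induced_pspace K u t = singular_homology K 0 (?X t)" if "0 < t" for t
    using that by (simp add: induced_pspace_def)
  have lin: "homology_map K 0 (?X t) id \<in> linear_maps K (induced_pspace K u s) (induced_pspace K u t)"
    if s: "0 < s" "s \<le> t" for s t
  proof -
    interpret Vs: Module.module K "?V s" by (rule module_chain_space) fact
    have t: "0 < t" using s by simp
    let ?h = "homology_map K 0 (?X t) id"
    show ?thesis
      unfolding linear_maps_def ind [OF s(1)] ind [OF t] car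
    proof (intro CollectI conjI funcsetI ballI; (elim imageE)?; hypsubst)
      fix x assume x: "x \<in> carrier (?V s)"
      show "?h (?N s +>\<^bsub>?V s\<^esub> x) \<in> (\<lambda>x. ?N t +>\<^bsub>?V t\<^esub> x) ` carrier (?V t)"
        using x sub [OF s(2)] by (auto simp: hm [OF s(2) x])
      fix a assume a: "a \<in> carrier K"
      show "?h (a \<odot>\<^bsub>singular_homology K 0 (?X s)\<^esub> (?N s +>\<^bsub>?V s\<^esub> x)) =
          a \<odot>\<^bsub>singular_homology K 0 (?X t)\<^esub> ?h (?N s +>\<^bsub>?V s\<^esub> x)"
      proof -
        have "x \<in> carrier (?V t)" "a \<odot>\<^bsub>?V s\<^esub> x \<in> carrier (?V s)"
          using x a sub [OF s(2)] by auto
        then show ?thesis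
          unfolding Qsmult [OF a x] hm [OF s(2) x] Qsmult [OF a \<open>x \<in> carrier (?V t)\<close>]
          by (simp add: hm [OF s(2)] ops(2) [where s = s and t = t])
      qed
    next
      fix x y assume x: "x \<in> carrier (?V s)" and y: "y \<in> carrier (?V s)"
      show "?h ((?N s +>\<^bsub>?V s\<^esub> x) \<oplus>\<^bsub>singular_homology K 0 (?X s)\<^esub> (?N s +>\<^bsub>?V s\<^esub> y)) =
          ?h (?N s +>\<^bsub>?V s\<^esub> x) \<oplus>\<^bsub>singular_homology K 0 (?X t)\<^esub> ?h (?N s +>\<^bsub>?V s\<^esub> y)"
      proof -
        have t: "x \<in> carrier (?V t)" "y \<in> carrier (?V t)"
          and "x \<oplus>\<^bsub>?V s\<^esub> y \<in> carrier (?V s)"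
          using x y sub [OF s(2)] by auto
        then show ?thesis
          unfolding Qadd [OF x y] hm [OF s(2) x] hm [OF s(2) y] Qadd [OF t]
          by (subst hm [OF s(2)]) (simp_all add: ops(1) [where s = s and t = t])
      qed
    qed
  qed
  have lin0: "(\<lambda>_. \<zero>\<^bsub>W\<^esub>) \<in> linear_maps K V W"
    if "Module.module K V" "Module.module K W" for V W :: "('a, (complex sing_simplex \<Rightarrow> 'a) set) module"
  proof -
    interpret V: Module.module K V by fact
    interpret W: Module.module K W by fact
    show ?thesis by (auto simp: linear_maps_def)
  qed
  have z: "carrier (induced_pspace K u t) = {\<zero>\<^bsub>induced_pspace K u t\<^esub>}" if "\<not> 0 < t" for t
    using that by (simp add: induced_pspace_def zero_space_def)
  have lz: "f \<zero>\<^bsub>V\<^esub> = \<zero>\<^bsub>W\<^esub>"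
    if "f \<in> linear_maps K V W" "Module.module K V" "Module.module K W" for f and V W :: "('a, (complex sing_simplex \<Rightarrow> 'a) set) module"
  proof -
    interpret V: Module.module K V by fact
    interpret W: Module.module K W by fact
    have "f (\<zero>\<^bsub>K\<^esub> \<odot>\<^bsub>V\<^esub> \<zero>\<^bsub>V\<^esub>) = \<zero>\<^bsub>K\<^esub> \<odot>\<^bsub>W\<^esub> f \<zero>\<^bsub>V\<^esub>" "f \<zero>\<^bsub>V\<^esub> \<in> carrier W"
      using that(1) zero_closed V.M.zero_closed unfolding linear_maps_def by blast+
    then show ?thesis by simp
  qed
  show ?thesis
    unfolding persistence_module_def
  proof (intro conjI allI impI ballI)
    show "Module.module K (pspace (induced_module K u) t)" for t
      by (simp add: induced_module_def mod)
  next
    fix s t :: real assume "s \<le> t"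
    then show "pmap (induced_module K u) s t
        \<in> linear_maps K (pspace (induced_module K u) s) (pspace (induced_module K u) t)"
      by (auto simp: induced_module_def lin lin0 mod)
  next
    fix s t r x assume st: "s \<le> t \<and> t \<le> r" and x: "x \<in> carrier (pspace (induced_module K u) s)"
    show "pmap (induced_module K u) s r x =
        pmap (induced_module K u) t r (pmap (induced_module K u) s t x)"
    proof (cases "0 < s")
      case True
      with x st obtain c where "c \<in> carrier (?V s)" "x = ?N s +>\<^bsub>?V s\<^esub> c"
        by (auto simp: induced_module_def ind car)
      then show ?thesis using True st sub [of s t] sub [of s r]
        by (auto simp: induced_module_def hm subset_iff)
    next
      case False
      then show ?thesis using st lz [OF lin mod mod, of t r]
        by (auto simp: induced_module_def)
    qed
  next
    fix t x assume x: "x \<in> carrier (pspace (induced_module K u) t)"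
    show "pmap (induced_module K u) t t x = x"
      using x z [of t] by (auto simp: induced_module_def ind car hm)
  next
    show "\<exists>t\<^sub>0. \<forall>s\<le>t\<^sub>0. carrier (pspace (induced_module K u) s) = {\<zero>\<^bsub>pspace (induced_module K u) s\<^esub>}"
      using z by (intro exI [of _ 0]) (auto simp: induced_module_def)
  qed
qed

end

theory Submission
  imports Defs "HOL-Complex_Analysis.Complex_Analysis"
begin

text \<open>Two inner functions \<open>u\<close>, \<open>v\<close> with \<open>\<bar>u - v\<bar> \<le> 1/4\<close> satisfy
  \<open>1 - \<bar>u\<bar>\<^sup>2 \<le> 74 (1 - \<bar>v\<bar>\<^sup>2)\<close> on the whole disk.  The set of path parameters being connected,
  \<open>1 - \<bar>B\<bar>\<^sup>2\<close> and \<open>1 - \<bar>B'\<bar>\<^sup>2\<close> are then comparable up to a constant.  In the parametrization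
  \<open>\<theta>(t) = tanh (t/2)\<close> this says that the sublevel sets of \<open>B\<close> and \<open>B'\<close> are contained in one
  another after a shift by some constant, so the inclusions interleave the modules.\<close>

section \<open>Harmonic functions dominated at the boundary\<close>

text \<open>The factor 1/(2 pi) is left out, so the kernel has integral 2 pi over a period.\<close>

definition poisson_kernel :: "real \<Rightarrow> complex \<Rightarrow> real \<Rightarrow> real" where
  "poisson_kernel R z t = (R\<^sup>2 - (cmod z)\<^sup>2) / (cmod (of_real R * cis t - z))\<^sup>2"

text \<open>Cauchy's formula on the circle of radius \<open>R\<close> for
  \<open>\<Phi> w * (c / (R^2 - cnj z * w))\<close>. This function is holomorphic on the closed disk
  and takes the value \<open>\<Phi> z\<close> at \<open>z\<close>; on the circle the extra factor
  turns the kernel \<open>w / (w - z)\<close> into the Poisson kernel.\<close>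

lemma poisson_formula:
  assumes hol: "\<Phi> holomorphic_on ball 0 1" and z: "cmod z < R" and R: "R < 1"
  shows "((\<lambda>t. of_real (poisson_kernel R z t) * \<Phi> (of_real R * cis t))
           has_integral of_real (2 * pi) * \<Phi> z) {0..2*pi}"
proof -
  have R0: "0 < R" using z norm_ge_zero [of z] by linarith
  define c :: complex where "c = of_real (R\<^sup>2 - (cmod z)\<^sup>2)"
  define g where "g w = \<Phi> w * (c / (of_real (R\<^sup>2) - cnj z * w))" for w
  have den: "of_real (R\<^sup>2) - cnj z * w \<noteq> 0" if "cmod w \<le> R" for w
  proof
    assume "of_real (R\<^sup>2) - cnj z * w = 0"
    then have "cmod (of_real (R\<^sup>2)) = cmod (cnj z * w)" by simp
    then have "R * R = cmod z * cmod w" by (simp add: norm_mult norm_power power2_eq_square)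
    moreover have "cmod z * cmod w \<le> cmod z * R" using that by (intro mult_left_mono) auto
    moreover have "cmod z * R < R * R" using z R0 by simp
    ultimately show False by linarith
  qed
  have "g holomorphic_on cball 0 R"
    unfolding g_def
    by (intro holomorphic_intros holomorphic_on_subset [OF hol]) (use den R in \<open>auto simp: dist_norm\<close>)
  then have "((\<lambda>u. g u / (u - z)) has_contour_integral (2 * of_real pi * \<i> * g z)) (circlepath 0 R)"
    by (rule Cauchy_integral_circlepath_simple) (use z in simp)
  then have "((\<lambda>t. g (of_real R * cis t) / (of_real R * cis t - z) * of_real R * \<i> * cis t)
      has_integral 2 * of_real pi * \<i> * g z) {0..2*pi}"
    unfolding circlepath_def by (subst (asm) has_contour_integral_part_circlepath_iff) auto
  then have "((\<lambda>t. (-\<i>) * (g (of_real R * cis t) / (of_real R * cis t - z) * of_real R * \<i> * cis t))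
      has_integral (-\<i>) * (2 * of_real pi * \<i> * g z)) {0..2*pi}"
    by (rule has_integral_mult_right)
  moreover have "(-\<i>) * (g (of_real R * cis t) / (of_real R * cis t - z) * of_real R * \<i> * cis t)
      = of_real (poisson_kernel R z t) * \<Phi> (of_real R * cis t)" for t
  proof -
    define w where "w = of_real R * cis t"
    have w: "cmod w = R" using R0 by (simp add: w_def norm_mult)
    have "of_real (R\<^sup>2) = w * cnj w" using w complex_norm_square [of w] by simp
    then have d: "of_real (R\<^sup>2) - cnj z * w = w * cnj (w - z)" by (simp add: algebra_simps)
    have w0: "w \<noteq> 0" using w R0 by auto
    have P: "of_real (poisson_kernel R z t) = c / ((w - z) * cnj (w - z))"
      unfolding poisson_kernel_def w_def [symmetric] c_def of_real_divide
      using complex_norm_square [of "w - z"] by simp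
    have "g w / (w - z) * w = of_real (poisson_kernel R z t) * \<Phi> w"
    proof -
      have "p * (c / (w * A)) / B * w = c / (B * A) * p" for p A B
        using w0 by (cases "A = 0"; cases "B = 0") (simp_all add: field_simps)
      then show ?thesis unfolding g_def d P .
    qed
    moreover have "(-\<i>) * (g w / (w - z) * of_real R * \<i> * cis t) = g w / (w - z) * w"
    proof -
      have "(-\<i>) * (x * of_real R * \<i> * cis t) = x * w" for x
        by (simp add: w_def algebra_simps)
      then show ?thesis .
    qed
    ultimately show ?thesis by (simp add: w_def)
  qed
  moreover have "(-\<i>) * (2 * of_real pi * \<i> * g z) = of_real (2 * pi) * \<Phi> z"
  proof -
    have "of_real (R\<^sup>2) - cnj z * z = c"
      unfolding c_def using complex_norm_square [of z] by (simp add: mult.commute)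
    then show ?thesis using den [of z] z by (simp add: g_def)
  qed
  ultimately show ?thesis by (simp only:)
qed

text \<open>Dominated convergence: by the unimodular radial limits the integrand tends to 0 almost
  everywhere. The bound \<open>1 + b^2\<close> uses boundedness alone, because
  \<open>|u| \<le> 1\<close> is derived only later, by means of this limit.\<close>

lemma inner_function_mean_tendsto:
  assumes u: "inner_function u" and r: "\<And>n. 0 < r n \<and> r n < 1" "r \<longlonglongrightarrow> 1"
  shows "(\<lambda>n. integral {0..2*pi} (\<lambda>t. \<bar>1 - (cmod (u (of_real (r n) * cis t)))\<^sup>2\<bar>)) \<longlonglongrightarrow> 0"
proof -
  let ?M = "lebesgue_on {0..2*pi::real}"
  let ?s = "\<lambda>n t. \<bar>1 - (cmod (u (of_real (r n) * cis t)))\<^sup>2\<bar>"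
  obtain b where b: "\<And>z. z \<in> ball 0 1 \<Longrightarrow> cmod (u z) \<le> b"
    using u unfolding inner_function_def bounded_iff by blast
  have in_ball: "of_real (r n) * cis t \<in> ball 0 1" for n t
    using r(1) [of n] by (simp add: norm_mult)
  have cu: "continuous_on (ball 0 1) u"
    using u holomorphic_on_imp_continuous_on unfolding inner_function_def by blast
  have cs: "continuous_on {0..2*pi} (?s n)" for n
    by (intro continuous_intros continuous_on_compose2 [OF cu] continuous_on_cis)
      (use in_ball in auto)
  have meas: "?s n \<in> borel_measurable ?M" for n
    by (rule continuous_imp_measurable_on_sets_lebesgue [OF cs]) simp
  have bound: "?s n t \<le> 1 + b\<^sup>2" for n t
  proof -
    have "(cmod (u (of_real (r n) * cis t)))\<^sup>2 \<le> b\<^sup>2"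
      using b [OF in_ball] by (intro power_mono) auto
    then show ?thesis using zero_le_power2 [of b] zero_le_power2 [of "cmod (u (of_real (r n) * cis t))"] by linarith
  qed
  have finm: "integrable ?M (\<lambda>_. 1 + b\<^sup>2)"
    by (rule finite_measure.integrable_const)
      (auto intro!: finite_measureI simp: emeasure_restrict_space)
  have "(\<lambda>n. integral\<^sup>L ?M (?s n)) \<longlonglongrightarrow> integral\<^sup>L ?M (\<lambda>_. 0)"
  proof (rule integral_dominated_convergence [where w = "\<lambda>_. 1 + b\<^sup>2"])
    have lim: "filterlim r (at_left 1) sequentially"
      using r by (auto simp: filterlim_at less_imp_neq intro!: always_eventually)
    have "AE t in ?M. \<exists>l. cmod l = 1 \<and> tendsto (\<lambda>r. u (of_real r * cis t)) l (at_left 1)"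
      using u unfolding inner_function_def by blast
    then show "AE t in ?M. (\<lambda>n. ?s n t) \<longlonglongrightarrow> 0"
    proof eventually_elim
      case (elim t)
      then obtain l where l: "cmod l = 1" "tendsto (\<lambda>r. u (of_real r * cis t)) l (at_left 1)" by blast
      have "(\<lambda>n. ?s n t) \<longlonglongrightarrow> \<bar>1 - (cmod l)\<^sup>2\<bar>"
        by (intro tendsto_intros filterlim_compose [OF l(2) lim])
      then show ?case using l by simp
    qed
  qed (use meas finm bound in auto)
  moreover have "integral\<^sup>L ?M (?s n) = integral {0..2*pi} (?s n)" for n
  proof (rule lebesgue_integral_eq_integral)
    show "integrable ?M (?s n)"
      by (rule Bochner_Integration.integrable_bound [OF finm meas])
        (use bound in \<open>auto intro!: AE_I2 order_trans [OF bound]\<close>)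
  qed simp
  ultimately show ?thesis by simp
qed

text \<open>Since \<open>1 - \<bar>u\<bar>\<^sup>2\<close> vanishes on the boundary, a harmonic function dominating
  \<open>1 - c (1 - \<bar>u\<bar>\<^sup>2)\<close> also dominates \<open>1\<close>.\<close>

lemma inner_function_harmonic_domination:
  assumes u: "inner_function u" and hol: "\<Phi> holomorphic_on ball 0 1"
    and dom: "\<And>w. w \<in> ball 0 1 \<Longrightarrow> 1 - c * (1 - (cmod (u w))\<^sup>2) \<le> Re (\<Phi> w)"
    and z: "z \<in> ball 0 1"
  shows "1 \<le> Re (\<Phi> z)"
proof -
  \<comment> \<open>\<open>d\<close> is half the distance from \<open>z\<close> to the unit circle.
    All radii \<open>r n\<close> exceed \<open>cmod z\<close> by at least \<open>d\<close>, so the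
    Poisson kernels have the common bound \<open>1 / d^2\<close>.\<close>
  define d where "d = (1 - cmod z) / 2"
  have z1: "cmod z < 1" using z by simp
  then have d0: "0 < d" by (simp add: d_def)
  define r where "r n = 1 - d / of_nat (Suc n)" for n
  have dn: "0 < d / of_nat (Suc n)" "d / of_nat (Suc n) \<le> d" for n
    using d0 by (auto simp: field_simps)
  have r: "r n < 1" "cmod z + d \<le> r n" for n
    using dn [of n] by (auto simp: r_def d_def field_simps simp del: of_nat_Suc)
  have r0: "0 < r n" for n using r(2) [of n] d0 norm_ge_zero [of z] by linarith
  have rlim: "r \<longlonglongrightarrow> 1"
  proof -
    have "(\<lambda>n. 1 - d * inverse (of_nat (Suc n))) \<longlonglongrightarrow> 1 - d * 0"
      by (intro tendsto_intros LIMSEQ_inverse_real_of_nat)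
    then show ?thesis by (simp add: r_def [abs_def] divide_inverse)
  qed
  let ?I = "\<lambda>n. integral {0..2*pi} (\<lambda>t. \<bar>1 - (cmod (u (of_real (r n) * cis t)))\<^sup>2\<bar>)"
  have I0: "?I \<longlonglongrightarrow> 0"
    by (rule inner_function_mean_tendsto [OF u]) (use r r0 rlim in auto)
  \<comment> \<open>Integrate the hypothesis against the Poisson kernel, whose total mass comes from
    the formula for the constant 1. Absolute values are taken because neither \<open>c\<close> nor
    \<open>1 - |u|^2\<close> has a known sign at this stage.\<close>
  have le: "2 * pi - \<bar>c\<bar> / d\<^sup>2 * ?I n \<le> 2 * pi * Re (\<Phi> z)" for n
  proof -
    let ?w = "\<lambda>t. of_real (r n) * cis t"
    let ?P = "poisson_kernel (r n) z"
    have zr: "cmod z < r n" using r(2) [of n] d0 by linarith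
    have wb: "?w t \<in> ball 0 1" for t using r(1) [of n] r0 [of n] by (simp add: norm_mult)
    have P0: "0 \<le> ?P t" for t
      unfolding poisson_kernel_def using zr by (intro divide_nonneg_nonneg) (auto intro: power_mono)
    have P1: "?P t \<le> 1 / d\<^sup>2" for t
      unfolding poisson_kernel_def
    proof (rule frac_le)
      show "(r n)\<^sup>2 - (cmod z)\<^sup>2 \<le> 1"
        using r(1) [of n] r0 [of n] power_le_one [of "r n" 2] zero_le_power2 [of "cmod z"] by linarith
      have "d \<le> cmod (?w t - z)"
        using norm_triangle_ineq2 [of "?w t" z] r(2) [of n] r0 [of n] by (simp add: norm_mult)
      then show "d\<^sup>2 \<le> (cmod (?w t - z))\<^sup>2" using d0 by (intro power_mono) auto
    qed (use d0 in auto)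
    have "((\<lambda>t. Re (of_real (?P t) * 1)) has_integral Re (of_real (2 * pi) * 1)) {0..2*pi}"
      using poisson_formula [OF holomorphic_on_const zr r(1), of 1] by (intro has_integral_Re) simp
    then have int1: "(?P has_integral 2 * pi) {0..2*pi}" by simp
    have "((\<lambda>t. Re (of_real (?P t) * \<Phi> (?w t))) has_integral Re (of_real (2 * pi) * \<Phi> z)) {0..2*pi}"
      by (intro has_integral_Re poisson_formula [OF hol zr r(1)])
    then have int2: "((\<lambda>t. ?P t * Re (\<Phi> (?w t))) has_integral 2 * pi * Re (\<Phi> z)) {0..2*pi}"
      by simp
    have cu: "continuous_on (ball 0 1) u"
      using u holomorphic_on_imp_continuous_on unfolding inner_function_def by blast
    have "continuous_on {0..2*pi} (\<lambda>t. \<bar>1 - (cmod (u (?w t)))\<^sup>2\<bar>)"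
      by (intro continuous_intros continuous_on_compose2 [OF cu] continuous_on_cis)
        (use wb in auto)
    then have "((\<lambda>t. \<bar>1 - (cmod (u (?w t)))\<^sup>2\<bar>) has_integral ?I n) {0..2*pi}"
      by (intro integrable_integral integrable_continuous_real)
    then have int3: "((\<lambda>t. ?P t - \<bar>c\<bar> / d\<^sup>2 * \<bar>1 - (cmod (u (?w t)))\<^sup>2\<bar>) has_integral
        (2 * pi - \<bar>c\<bar> / d\<^sup>2 * ?I n)) {0..2*pi}"
      by (intro has_integral_diff has_integral_mult_right int1)
    show ?thesis
    proof (rule has_integral_le [OF int3 int2])
      fix t
      let ?a = "1 - (cmod (u (?w t)))\<^sup>2"
      have "?P t * (c * ?a) \<le> ?P t * (\<bar>c\<bar> * \<bar>?a\<bar>)"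
        using P0 by (intro mult_left_mono) (auto simp: abs_mult [symmetric])
      also have "\<dots> \<le> 1 / d\<^sup>2 * (\<bar>c\<bar> * \<bar>?a\<bar>)"
        using P1 by (intro mult_right_mono) auto
      finally have "?P t - \<bar>c\<bar> / d\<^sup>2 * \<bar>?a\<bar> \<le> ?P t * (1 - c * ?a)" by (simp add: algebra_simps)
      also have "\<dots> \<le> ?P t * Re (\<Phi> (?w t))"
        using dom [OF wb] P0 by (intro mult_left_mono) auto
      finally show "?P t - \<bar>c\<bar> / d\<^sup>2 * \<bar>?a\<bar> \<le> ?P t * Re (\<Phi> (?w t))" .
    qed
  qed
  have "(\<lambda>n. 2 * pi - \<bar>c\<bar> / d\<^sup>2 * ?I n) \<longlonglongrightarrow> 2 * pi - \<bar>c\<bar> / d\<^sup>2 * 0"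
    by (intro tendsto_intros I0)
  then have "2 * pi \<le> 2 * pi * Re (\<Phi> z)"
    using LIMSEQ_le_const2 [of _ "2 * pi" "2 * pi * Re (\<Phi> z)"] le by auto
  then show ?thesis by simp
qed

section \<open>Inner functions that are close in the supremum norm\<close>

lemma cmod_diff_square: "(cmod (x - a))\<^sup>2 = (cmod x)\<^sup>2 - 2 * Re (cnj a * x) + (cmod a)\<^sup>2"
  unfolding cmod_power2 by (simp add: power2_eq_square algebra_simps)

text \<open>Harmonic domination with \<open>c = -1\<close>: the required inequality amounts to
  \<open>|u w - u z|^2 \<ge> 0\<close>, and at \<open>w = z\<close> the harmonic function equals
  \<open>2 - |u z|^2\<close>.\<close>

lemma inner_function_le_1:
  assumes "inner_function u" "z \<in> ball 0 1"
  shows "cmod (u z) \<le> 1"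
proof -
  let ?\<Phi> = "\<lambda>w. 2 - 2 * (cnj (u z) * u w) + of_real ((cmod (u z))\<^sup>2)"
  have "1 \<le> Re (?\<Phi> z)"
  proof (rule inner_function_harmonic_domination [OF assms(1), where \<Phi> = ?\<Phi> and c = "-1"])
    show "?\<Phi> holomorphic_on ball 0 1"
      using assms(1) unfolding inner_function_def by (intro holomorphic_intros) auto
    show "1 - (-1) * (1 - (cmod (u w))\<^sup>2) \<le> Re (?\<Phi> w)" if "w \<in> ball 0 1" for w
      using cmod_diff_square [of "u w" "u z"] zero_le_power2 [of "cmod (u w - u z)"] by simp
  qed (fact assms)
  moreover have "Re (cnj (u z) * u z) = (cmod (u z))\<^sup>2"
    unfolding cmod_power2 by (simp add: power2_eq_square)
  ultimately have "(cmod (u z))\<^sup>2 \<le> 1" by simp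
  then show ?thesis by (simp add: power_le_one_iff)
qed

text \<open>If \<open>\<bar>h\<bar> = 1\<close> then \<open>h - 1/h\<close> is purely imaginary, so its real part
  measures the distance of \<open>h\<close> to the unit circle.\<close>

lemma near_unit_circle_estimate:
  fixes h b :: complex
  defines "G \<equiv> h - 1 / h" and "G0 \<equiv> b - 1 / b"
  assumes "1/2 \<le> Re h" "\<bar>Im h\<bar> \<le> 1/4" "1/2 \<le> Re b" "\<bar>Im b\<bar> \<le> 1/4"
  shows "(cmod (h - b))\<^sup>2 \<le> 2 * (Re (G - G0))\<^sup>2 - Re ((G - G0)\<^sup>2)"
    and "(Re G)\<^sup>2 \<le> 9 * (cmod h - 1)\<^sup>2"
proof -
  have h0: "h \<noteq> 0" "b \<noteq> 0" using assms by auto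
  \<comment> \<open>Both points lie in a narrow sector around the positive axis, so
    \<open>h * b\<close> has nonnegative real part and \<open>1 + 1 / (h * b)\<close> has modulus at
    least 1. Hence passing from \<open>h\<close> to \<open>h - 1 / h\<close> does not shrink
    distances.\<close>
  have "\<bar>Im h * Im b\<bar> \<le> 1/4 * (1/4)" unfolding abs_mult using assms by (intro mult_mono) auto
  moreover have "1/2 * (1/2) \<le> Re h * Re b" using assms by (intro mult_mono) auto
  ultimately have "0 \<le> Re (h * b)" by (simp add: abs_le_iff)
  then have "0 \<le> Re (1 / (h * b))" by (simp add: Re_divide)
  then have "1 \<le> Re (1 + 1 / (h * b))" by simp
  then have ge1: "1 \<le> cmod (1 + 1 / (h * b))" using complex_Re_le_cmod order_trans by blast
  have "G - G0 = (h - b) * (1 + 1 / (h * b))"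
    unfolding G_def G0_def using h0 by (simp add: field_simps)
  then have "cmod (G - G0) = cmod (h - b) * cmod (1 + 1 / (h * b))" by (simp add: norm_mult)
  then have "cmod (h - b) \<le> cmod (G - G0)" using ge1 by (simp add: mult_le_cancel_left1)
  then have "(cmod (h - b))\<^sup>2 \<le> (cmod (G - G0))\<^sup>2" by (intro power_mono) auto
  \<comment> \<open>The squared modulus is split so that only the square of the real part fails to
    be harmonic when \<open>G\<close> is a holomorphic function.\<close>
  also have "\<dots> = 2 * (Re (G - G0))\<^sup>2 - Re ((G - G0)\<^sup>2)"
    unfolding cmod_power2 by (simp add: power2_eq_square)
  finally show "(cmod (h - b))\<^sup>2 \<le> 2 * (Re (G - G0))\<^sup>2 - Re ((G - G0)\<^sup>2)" .
  define m where "m = cmod h"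
  have m: "1/2 \<le> m" using assms complex_Re_le_cmod [of h] by (simp add: m_def)
  have "Re G = Re h * (m\<^sup>2 - 1) / m\<^sup>2"
  proof -
    have "Re (1 / h) = Re h / m\<^sup>2" by (simp add: Re_divide m_def cmod_power2)
    then show ?thesis using m unfolding G_def by (simp add: field_simps)
  qed
  then have "\<bar>Re G\<bar> = \<bar>Re h\<bar> * (\<bar>m - 1\<bar> * (m + 1)) / m\<^sup>2"
  proof -
    have "m\<^sup>2 - 1 = (m - 1) * (m + 1)" by (simp add: power2_eq_square algebra_simps)
    then show ?thesis using m \<open>Re G = _\<close> by (simp add: abs_mult)
  qed
  \<comment> \<open>\<open>m + 1 \<le> 3 * m\<close> because \<open>m \<ge> 1/2\<close>; the 9 in
    the claim is the square of this 3.\<close>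
  also have "\<dots> \<le> m * (\<bar>m - 1\<bar> * (3 * m)) / m\<^sup>2"
    using m abs_Re_le_cmod [of h] unfolding m_def [symmetric]
    by (intro divide_right_mono mult_mono) auto
  also have "\<dots> = 3 * \<bar>m - 1\<bar>" using m by (simp add: power2_eq_square)
  finally have "\<bar>Re G\<bar>\<^sup>2 \<le> (3 * \<bar>m - 1\<bar>)\<^sup>2" by (intro power_mono) auto
  then show "(Re G)\<^sup>2 \<le> 9 * (cmod h - 1)\<^sup>2" by (simp add: m_def power_mult_distrib)
qed

text \<open>The mean oscillation of an inner function \<open>u\<close> about \<open>u z\<close> with respect to harmonic
  measure at \<open>z\<close> is \<open>1 - \<bar>u z\<bar>\<^sup>2\<close>.  When \<open>\<alpha> = v z\<close> is close to the unit circle,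
  \<open>\<alpha> + (u - v)\<close> has modulus close to \<open>1\<close> in mean square, hence is
  nearly constant, and \<open>u\<close> oscillates little more than \<open>v\<close>.\<close>

lemma inner_function_defect_le:
  assumes u: "inner_function u" and v: "inner_function v"
    and near: "\<And>w. w \<in> ball 0 1 \<Longrightarrow> cmod (u w - v w) \<le> 1/4"
    and z: "z \<in> ball 0 1"
  shows "1 - (cmod (u z))\<^sup>2 \<le> 74 * (1 - (cmod (v z))\<^sup>2)"
proof (cases "3/4 \<le> cmod (v z)")
  \<comment> \<open>Here the right-hand side is at least \<open>74 * 7/16\<close>, which exceeds
    1.\<close>
  case False
  then have "(cmod (v z))\<^sup>2 \<le> (3/4)\<^sup>2" by (intro power_mono) auto
  then have "(cmod (v z))\<^sup>2 \<le> 9/16" by (simp add: power_divide)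
  then show ?thesis using zero_le_power2 [of "cmod (u z)"] unfolding right_diff_distrib by linarith
next
  case True
  define \<alpha> where "\<alpha> = v z"
  define \<beta> where "\<beta> = u z"
  \<comment> \<open>Dividing by \<open>\<kappa>\<close> rotates \<open>\<alpha>\<close> to the
    positive axis. Then \<open>h\<close> stays within 1/4 of a point of \<open>[3/4, 1]\<close>, the
    region where \<open>near_unit_circle_estimate\<close> applies.\<close>
  define \<kappa> where "\<kappa> = \<alpha> / of_real (cmod \<alpha>)"
  have \<alpha>: "3/4 \<le> cmod \<alpha>" "cmod \<alpha> \<le> 1"
    using True inner_function_le_1 [OF v z] by (auto simp: \<alpha>_def)
  have \<kappa>: "cmod \<kappa> = 1" "\<kappa> \<noteq> 0" "\<alpha> = \<kappa> * of_real (cmod \<alpha>)"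
    using \<alpha> by (auto simp: \<kappa>_def norm_divide)
  define h where "h w = (\<alpha> + (u w - v w)) / \<kappa>" for w
  define G where "G w = h w - 1 / h w" for w
  define b where "b = h z"
  define k where "k = Re (G z)"
  have hb: "1/2 \<le> Re (h w)" "\<bar>Im (h w)\<bar> \<le> 1/4" if "w \<in> ball 0 1" for w
  proof -
    have "h w - of_real (cmod \<alpha>) = (u w - v w) / \<kappa>"
      using \<kappa> by (simp add: h_def field_simps)
    then have "cmod (h w - of_real (cmod \<alpha>)) \<le> 1/4"
      using near [OF that] \<kappa> by (simp add: norm_divide)
    then show "1/2 \<le> Re (h w)" "\<bar>Im (h w)\<bar> \<le> 1/4"
      using abs_Re_le_cmod [of "h w - of_real (cmod \<alpha>)"] abs_Im_le_cmod [of "h w - of_real (cmod \<alpha>)"] \<alpha>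
      by auto
  qed
  have uh: "u w = \<kappa> * h w + (v w - \<alpha>)" for w using \<kappa> by (simp add: h_def)
  have \<beta>: "\<beta> = \<kappa> * b" unfolding \<beta>_def b_def uh by (simp add: \<alpha>_def)
  have hol: "u holomorphic_on ball 0 1" "v holomorphic_on ball 0 1"
    using u v unfolding inner_function_def by auto
  have hol_h: "h holomorphic_on ball 0 1"
    unfolding h_def using \<kappa> by (intro holomorphic_intros hol) auto
  have hol_G: "G holomorphic_on ball 0 1"
    unfolding G_def using hb by (intro holomorphic_intros hol_h) fastforce
  \<comment> \<open>The first two terms have real part \<open>|u w|^2 - |u w - \<beta>|^2\<close>.
    Those with \<open>G\<close> and \<open>k\<close> have real part at least
    \<open>2 |h w - b|^2 - 4 (Re (G w))^2\<close>, and the subtracted part is at most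
    \<open>72 (|v w - \<alpha>|^2 + 1 - |u w|^2)\<close>, where 72 = 4 * 9 * 2. The last term
    majorizes \<open>74 |v w - \<alpha>|^2\<close>: 72 for this loss and 2 for splitting
    \<open>u w - \<beta>\<close>. What remains is \<open>|u w|^2 - 72 (1 - |u w|^2)\<close>, whence
    \<open>c = 73\<close>.\<close>
  let ?\<Phi> = "\<lambda>w. 2 * (cnj \<beta> * u w) - of_real ((cmod \<beta>)\<^sup>2) - 8 * of_real k * G w + 4 * of_real (k\<^sup>2)
    - 2 * (G w - G z)\<^sup>2 + 74 * (1 - 2 * (cnj \<alpha> * v w) + of_real ((cmod \<alpha>)\<^sup>2))"
  have "1 \<le> Re (?\<Phi> z)"
  proof (rule inner_function_harmonic_domination [OF u, where \<Phi> = ?\<Phi> and c = 73])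
    show "?\<Phi> holomorphic_on ball 0 1" by (intro holomorphic_intros hol hol_G)
    fix w :: complex assume w: "w \<in> ball 0 1"
    let ?a = "(cmod (v w - \<alpha>))\<^sup>2" and ?m = "cmod (u w)"
    have m: "?m \<le> 1" by (rule inner_function_le_1 [OF u w])
    have vw: "cmod (v w) \<le> 1" by (rule inner_function_le_1 [OF v w])
    have sq: "(x + y)\<^sup>2 \<le> 2 * x\<^sup>2 + 2 * y\<^sup>2" for x y :: real
      using zero_le_power2 [of "x - y"] by (simp add: power2_eq_square algebra_simps)
    have "cmod (h w) = cmod (\<kappa> * h w)" using \<kappa> by (simp add: norm_mult)
    also have "\<kappa> * h w = u w - (v w - \<alpha>)" using uh [of w] by (simp add: algebra_simps)
    finally have "\<bar>cmod (h w) - ?m\<bar> \<le> cmod (v w - \<alpha>)"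
      using norm_triangle_ineq3 [of "u w - (v w - \<alpha>)" "u w"] by (simp add: norm_minus_commute)
    then have "\<bar>cmod (h w) - 1\<bar> \<le> cmod (v w - \<alpha>) + (1 - ?m)" using m by linarith
    then have "\<bar>cmod (h w) - 1\<bar>\<^sup>2 \<le> (cmod (v w - \<alpha>) + (1 - ?m))\<^sup>2" by (intro power_mono) auto
    also have "\<dots> \<le> 2 * ?a + 2 * (1 - ?m)\<^sup>2" by (rule sq)
    finally have 1: "(cmod (h w) - 1)\<^sup>2 \<le> 2 * ?a + 2 * (1 - ?m)\<^sup>2" by simp
    have 2: "(Re (G w))\<^sup>2 \<le> 9 * (cmod (h w) - 1)\<^sup>2"
      and 3: "(cmod (h w - b))\<^sup>2 \<le> 2 * (Re (G w - G z))\<^sup>2 - Re ((G w - G z)\<^sup>2)"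
      using near_unit_circle_estimate [OF hb [OF w] hb [OF z]] by (auto simp: G_def b_def)
    have "u w - \<beta> = \<kappa> * (h w - b) + (v w - \<alpha>)" unfolding uh \<beta> by (simp add: algebra_simps)
    then have "cmod (u w - \<beta>) \<le> cmod (h w - b) + cmod (v w - \<alpha>)"
      using norm_triangle_ineq [of "\<kappa> * (h w - b)" "v w - \<alpha>"] \<kappa> by (simp add: norm_mult)
    then have "(cmod (u w - \<beta>))\<^sup>2 \<le> (cmod (h w - b) + cmod (v w - \<alpha>))\<^sup>2" by (intro power_mono) auto
    also have "\<dots> \<le> 2 * (cmod (h w - b))\<^sup>2 + 2 * ?a" by (rule sq)
    finally have 4: "(cmod (u w - \<beta>))\<^sup>2 \<le> 2 * (cmod (h w - b))\<^sup>2 + 2 * ?a" .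
    have 5: "(Re (G w - G z))\<^sup>2 = (Re (G w))\<^sup>2 - 2 * (k * Re (G w)) + k\<^sup>2"
      by (simp add: k_def power2_eq_square algebra_simps)
    have "(1 - ?m) * (1 - ?m) \<le> (1 - ?m) * (1 + ?m)" using m by (intro mult_left_mono) auto
    then have 6: "(1 - ?m)\<^sup>2 \<le> 1 - ?m\<^sup>2" by (simp add: power2_eq_square algebra_simps)
    have 7: "?a \<le> 1 - 2 * Re (cnj \<alpha> * v w) + (cmod \<alpha>)\<^sup>2"
      unfolding cmod_diff_square using vw power_le_one [of "cmod (v w)" 2] by simp
    define q where "q = 1 - 2 * Re (cnj \<alpha> * v w) + (cmod \<alpha>)\<^sup>2"
    have 8: "Re (?\<Phi> w) = 2 * Re (cnj \<beta> * u w) - (cmod \<beta>)\<^sup>2 - 8 * (k * Re (G w)) + 4 * k\<^sup>2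
        - 2 * Re ((G w - G z)\<^sup>2) + 74 * q"
    proof -
      have "Re (8 * of_real k * x) = 8 * (k * Re x)" "Re (4 * of_real x') = 4 * x'"
        "Re (2 * x) = 2 * Re x" "Re (74 * x) = 74 * Re x" for x x'
        by simp_all
      then show ?thesis
        unfolding q_def by (simp only: minus_complex.sel plus_complex.sel one_complex.sel Re_complex_of_real)
    qed
    have "73 * ?m\<^sup>2 - 72 \<le> Re (?\<Phi> w)"
      using 1 2 3 4 5 6 7 cmod_diff_square [of "u w" \<beta>] unfolding 8 q_def [symmetric] by linarith
    then show "1 - 73 * (1 - ?m\<^sup>2) \<le> Re (?\<Phi> w)" unfolding right_diff_distrib by linarith
  qed (fact z)
  \<comment> \<open>At \<open>z\<close> the oscillation vanishes, and the leftover
    \<open>- 4 * k^2\<close> has the favourable sign.\<close>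
  moreover have "Re (?\<Phi> z) = (cmod \<beta>)\<^sup>2 - 4 * k\<^sup>2 + 74 * (1 - (cmod \<alpha>)\<^sup>2)"
    unfolding \<alpha>_def [symmetric] \<beta>_def [symmetric] cmod_power2 by (simp add: k_def power2_eq_square)
  ultimately have "1 \<le> (cmod \<beta>)\<^sup>2 + 74 * (1 - (cmod \<alpha>)\<^sup>2)"
    using zero_le_power2 [of k] unfolding right_diff_distrib by linarith
  then show ?thesis by (simp add: \<alpha>_def \<beta>_def)
qed

section \<open>Shifted sublevel sets and comparison along a path\<close>

text \<open>For \<open>0 \<le> x < 1\<close>, \<open>x < level_param t\<close> means
  \<open>(1 + x) / (1 - x) < exp t\<close>. The left side is \<open>(1 + x)^2 / (1 - x^2)\<close>
  with \<open>1 \<le> (1 + x)^2 \<le> 4\<close>, so a factor \<open>C\<close> between the defects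
  costs at most a factor \<open>4 * C\<close> in \<open>exp t\<close>.\<close>

lemma sublevel_param_shift:
  assumes "\<And>z. z \<in> ball 0 1 \<Longrightarrow> 1 - (cmod (u z))\<^sup>2 \<le> C * (1 - (cmod (v z))\<^sup>2)"
    and C: "0 < C" "4 * C \<le> exp \<Delta>"
  shows "sublevel u (level_param t) \<subseteq> sublevel v (level_param (t + \<Delta>))"
proof
  fix z assume "z \<in> sublevel u (level_param t)"
  then have z: "z \<in> ball 0 1" and less: "cmod (u z) < level_param t" by (auto simp: sublevel_def)
  define x where "x = cmod (u z)"
  define y where "y = cmod (v z)"
  define E where "E = exp t"
  have xy: "0 \<le> x" "0 \<le> y" and E: "0 < E" by (auto simp: x_def y_def E_def)
  have "x < (E - 1) / (E + 1)" using less by (simp add: x_def E_def level_param_def)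
  then have x: "1 + x < E * (1 - x)" using E by (simp add: field_simps)
  then have x1: "x < 1" using xy E by (smt (verit) mult_nonneg_nonpos)
  have le: "(1 - x) * (1 + x) \<le> C * ((1 - y) * (1 + y))"
    using assms(1) [OF z] by (simp add: x_def y_def power2_eq_square algebra_simps)
  moreover have "0 < (1 - x) * (1 + x)" using x1 xy by simp
  ultimately have "0 < (1 - y) * (1 + y)" using C(1) by (metis less_le_trans zero_less_mult_pos)
  then have y1: "y < 1" using xy by (simp add: zero_less_mult_iff)
  have "(1 + y) * (1 + y) \<le> 2 * 2" using y1 xy by (intro mult_mono) auto
  also have "\<dots> \<le> 4 * ((1 + x) * (1 + x))" using xy by (simp add: algebra_simps)
  also have "\<dots> < 4 * ((E * (1 - x)) * (1 + x))"
    using x xy by (intro mult_strict_left_mono mult_strict_right_mono) auto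
  also have "\<dots> \<le> E * (4 * C) * ((1 - y) * (1 + y))"
    using mult_left_mono [OF le, of "4 * E"] E by (simp add: algebra_simps)
  also have "\<dots> \<le> E * exp \<Delta> * ((1 - y) * (1 + y))"
    using C E y1 xy by (intro mult_right_mono mult_left_mono) auto
  also have "\<dots> = (exp (t + \<Delta>) * (1 - y)) * (1 + y)" by (simp add: E_def exp_add)
  finally have "1 + y < exp (t + \<Delta>) * (1 - y)"
    using xy by (simp add: mult_less_cancel_right)
  moreover have "0 < exp (t + \<Delta>) + 1" by (simp add: add_pos_pos)
  ultimately have "y < level_param (t + \<Delta>)" by (simp add: level_param_def field_simps)
  then show "z \<in> sublevel v (level_param (t + \<Delta>))" using z by (simp add: sublevel_def y_def)
qed

lemma joined_inner_functions_defect_le: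
  assumes "joined_by_sup_norm_path S u v" and S: "\<And>w. w \<in> S \<Longrightarrow> inner_function w"
  obtains C where "0 < C"
    "\<And>z. z \<in> ball 0 1 \<Longrightarrow> 1 - (cmod (u z))\<^sup>2 \<le> C * (1 - (cmod (v z))\<^sup>2)"
    "\<And>z. z \<in> ball 0 1 \<Longrightarrow> 1 - (cmod (v z))\<^sup>2 \<le> C * (1 - (cmod (u z))\<^sup>2)"
proof -
  obtain \<gamma> :: "real \<Rightarrow> complex \<Rightarrow> complex" where
    "\<forall>s\<in>{0..1}. \<gamma> s \<in> S"
    and lim: "\<forall>s\<in>{0..1}. tendsto (\<lambda>s'. sup_norm (\<lambda>z. \<gamma> s' z - \<gamma> s z)) 0 (at s within {0..1})"
    and ends: "\<forall>z\<in>ball 0 1. \<gamma> 0 z = u z" "\<forall>z\<in>ball 0 1. \<gamma> 1 z = v z"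
    using assms(1) unfolding joined_by_sup_norm_path_def by (elim exE conjE)
  then have \<gamma>: "inner_function (\<gamma> s)" if "s \<in> {0..1}" for s using S that by blast
  define D where "D s z = 1 - (cmod (\<gamma> s z))\<^sup>2" for s z
  define Q where "Q s s' \<longleftrightarrow>
    (\<exists>C>0. \<forall>z\<in>ball 0 1. D s z \<le> C * D s' z \<and> D s' z \<le> C * D s z)" for s s'
  have le1: "cmod (\<gamma> s z) \<le> 1" if "s \<in> {0..1}" "z \<in> ball 0 1" for s z
    using inner_function_le_1 \<gamma> that by blast
  have D0: "0 \<le> D s z" if "s \<in> {0..1}" "z \<in> ball 0 1" for s z
    using le1 [OF that] by (simp add: D_def power_le_one)
  \<comment> \<open>A real supremum bounds the values only if they are bounded above; here 2 is a
    bound.\<close>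
  have near: "cmod (\<gamma> s' z - \<gamma> s z) \<le> sup_norm (\<lambda>z. \<gamma> s' z - \<gamma> s z)"
    if "s \<in> {0..1}" "s' \<in> {0..1}" "z \<in> ball 0 1" for s s' z
    unfolding sup_norm_def
  proof (rule cSUP_upper [OF that(3)], rule bdd_aboveI2)
    show "cmod (\<gamma> s' w - \<gamma> s w) \<le> 1 + 1" if "w \<in> ball 0 1" for w
      using norm_triangle_ineq4 [of "\<gamma> s' w" "\<gamma> s w"] le1 [OF \<open>s \<in> _\<close> that] le1 [OF \<open>s' \<in> _\<close> that]
      by linarith
  qed
  \<comment> \<open>\<open>Q\<close> is an equivalence relation whose classes are open in the
    connected interval, so there is only one class. Constants multiply under transitivity.\<close>
  have "Q 0 1"
  proof (rule connected_equivalence_relation [of "{0..1::real}"])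
    fix a b assume "Q a b" then show "Q b a" unfolding Q_def by blast
  next
    fix a b c assume Q: "Q a b" "Q b c" and mem: "a \<in> {0..1}" "b \<in> {0..1}" "c \<in> {0..1}"
    from Q obtain A B where
      A: "A > 0" "\<And>z. z \<in> ball 0 1 \<Longrightarrow> D a z \<le> A * D b z" "\<And>z. z \<in> ball 0 1 \<Longrightarrow> D b z \<le> A * D a z" and
      B: "B > 0" "\<And>z. z \<in> ball 0 1 \<Longrightarrow> D b z \<le> B * D c z" "\<And>z. z \<in> ball 0 1 \<Longrightarrow> D c z \<le> B * D b z"
      unfolding Q_def by blast
    have "D a z \<le> A * B * D c z \<and> D c z \<le> A * B * D a z" if z: "z \<in> ball 0 1" for z
      using order_trans [OF A(2) [OF z] mult_left_mono [OF B(2) [OF z], of A]]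
        order_trans [OF B(3) [OF z] mult_left_mono [OF A(3) [OF z], of B]] A(1) B(1)
      by (simp add: mult_ac)
    then show "Q a c" unfolding Q_def using A(1) B(1) by (intro exI [of _ "A * B"]) auto
  next
    fix a :: real assume a: "a \<in> {0..1}"
    have "\<forall>\<^sub>F s in at a within {0..1}. sup_norm (\<lambda>z. \<gamma> s z - \<gamma> a z) < 1/4"
      using order_tendstoD(2) [OF bspec [OF lim a], of "1/4"] by simp
    then obtain \<epsilon> where "\<epsilon> > 0" and
      \<epsilon>: "\<And>s. \<lbrakk>s \<in> {0..1}; s \<noteq> a; dist s a < \<epsilon>\<rbrakk> \<Longrightarrow> sup_norm (\<lambda>z. \<gamma> s z - \<gamma> a z) < 1/4"
      unfolding eventually_at by blast
    have "Q a s" if s: "s \<in> {0..1}" "dist s a < \<epsilon>" for s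
    proof -
      \<comment> \<open>The limit at \<open>a\<close> says nothing about \<open>s = a\<close>, where
        the difference is 0.\<close>
      have n: "cmod (\<gamma> s z - \<gamma> a z) \<le> 1/4" if "z \<in> ball 0 1" for z
        using near [OF a s(1) that] \<epsilon> [OF s(1) _ s(2)] by (cases "s = a") auto
      then have n': "cmod (\<gamma> a z - \<gamma> s z) \<le> 1/4" if "z \<in> ball 0 1" for z
        using that by (metis norm_minus_commute)
      show ?thesis
        unfolding Q_def D_def
        using inner_function_defect_le [OF \<gamma> [OF a] \<gamma> [OF s(1)] n']
          inner_function_defect_le [OF \<gamma> [OF s(1)] \<gamma> [OF a] n]
        by (intro exI [of _ 74]) auto
    qed
    then show "\<exists>T. openin (top_of_set {0..1}) T \<and> a \<in> T \<and> (\<forall>x\<in>T. Q a x)"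
      using a \<open>\<epsilon> > 0\<close> by (intro exI [of _ "{0..1} \<inter> ball a \<epsilon>"]) (auto simp: dist_commute)
  qed auto
  then show thesis
    using that ends unfolding Q_def D_def by auto
qed

section \<open>Interleaving by inclusions\<close>

text \<open>Chains in \<open>S\<close> are chains in \<open>T\<close> with the same operations, and
  the coset of \<open>c\<close> goes to the coset of \<open>c\<close>. Arbitrary sets are allowed
  because \<open>S\<close> and \<open>T\<close> will be sublevel sets of different
  functions.\<close>

lemma homology_map_inclusion_linear:
  assumes K: "cring K" and ST: "S \<subseteq> T"
  shows "homology_map K 0 (top_of_set T) id
    \<in> linear_maps K (singular_homology K 0 (top_of_set S)) (singular_homology K 0 (top_of_set T))"
proof -
  let ?V = "\<lambda>S. chain_space K 0 (top_of_set S)" and ?N = "\<lambda>S. boundaries K 0 (top_of_set S)"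
  let ?h = "homology_map K 0 (top_of_set T) id"
  have H: "singular_homology K 0 (top_of_set S) = quotient_space (?V S) (?N S)" for S
    unfolding singular_homology_def cycles_0 [OF K] by simp
  note quot = module_quotient_space [OF module_chain_space [OF K] submodule_boundaries [OF K]]
  note hm = homology_map_coset [OF K ST]
  have sub: "x \<in> carrier (?V T)" if "x \<in> carrier (?V S)" for x
    using that chain_space_mono [OF ST] by blast
  have car: "carrier (quotient_space (?V S) (?N S)) = (\<lambda>x. ?N S +>\<^bsub>?V S\<^esub> x) ` carrier (?V S)" for S
    by (auto simp: quotient_space_def A_RCOSETS_def')
  have ops: "x \<oplus>\<^bsub>?V S\<^esub> y = x \<oplus>\<^bsub>?V T\<^esub> y" "a \<odot>\<^bsub>?V S\<^esub> x = a \<odot>\<^bsub>?V T\<^esub> x" for x y a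
    by (simp_all add: chain_space_def)
  interpret V: Module.module K "?V S" by (rule module_chain_space) fact
  show ?thesis
    unfolding linear_maps_def H
  proof (intro CollectI conjI funcsetI ballI; unfold car [of S]; elim imageE; hypsubst)
    fix x assume x: "x \<in> carrier (?V S)"
    show "?h (?N S +>\<^bsub>?V S\<^esub> x) \<in> carrier (quotient_space (?V T) (?N T))"
      using quot(2) [OF sub [OF x]] by (simp add: hm [OF x])
  next
    fix x y assume x: "x \<in> carrier (?V S)" and y: "y \<in> carrier (?V S)"
    show "?h ((?N S +>\<^bsub>?V S\<^esub> x) \<oplus>\<^bsub>quotient_space (?V S) (?N S)\<^esub> (?N S +>\<^bsub>?V S\<^esub> y)) =
        ?h (?N S +>\<^bsub>?V S\<^esub> x) \<oplus>\<^bsub>quotient_space (?V T) (?N T)\<^esub> ?h (?N S +>\<^bsub>?V S\<^esub> y)"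
      unfolding quot(3) [OF x y] hm [OF V.M.a_closed [OF x y]] hm [OF x] hm [OF y]
        quot(3) [OF sub [OF x] sub [OF y]] unfolding ops(1) ..
  next
    fix a x assume a: "a \<in> carrier K" and x: "x \<in> carrier (?V S)"
    show "?h (a \<odot>\<^bsub>quotient_space (?V S) (?N S)\<^esub> (?N S +>\<^bsub>?V S\<^esub> x)) =
        a \<odot>\<^bsub>quotient_space (?V T) (?N T)\<^esub> ?h (?N S +>\<^bsub>?V S\<^esub> x)"
      unfolding quot(4) [OF a x] hm [OF V.smult_closed [OF a x]] hm [OF x]
        quot(4) [OF a sub [OF x]] unfolding ops(2) ..
  qed
qed

lemma homology_map_inclusion_comp:
  assumes K: "cring K" and ST: "S \<subseteq> T" and TU: "T \<subseteq> U"
    and x: "x \<in> carrier (singular_homology K 0 (top_of_set S))"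
  shows "homology_map K 0 (top_of_set U) id (homology_map K 0 (top_of_set T) id x)
    = homology_map K 0 (top_of_set U) id x"
proof -
  let ?V = "chain_space K 0 (top_of_set S)"
  obtain c where c: "c \<in> carrier ?V" "x = boundaries K 0 (top_of_set S) +>\<^bsub>?V\<^esub> c"
    using x by (auto simp: singular_homology_def cycles_0 [OF K] quotient_space_def A_RCOSETS_def')
  have "c \<in> carrier (chain_space K 0 (top_of_set T))" using c(1) chain_space_mono [OF ST] by blast
  then show ?thesis
    unfolding c(2) homology_map_coset [OF K ST c(1)]
    using homology_map_coset [OF K TU] homology_map_coset [OF K order_trans [OF ST TU] c(1)] by simp
qed

lemma linear_maps_zero:
  assumes "f \<in> linear_maps K V W" "Module.module K V" "Module.module K W"
  shows "f \<zero>\<^bsub>V\<^esub> = \<zero>\<^bsub>W\<^esub>"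
proof -
  interpret V: Module.module K V by fact
  interpret W: Module.module K W by fact
  have "f (\<zero>\<^bsub>K\<^esub> \<odot>\<^bsub>V\<^esub> \<zero>\<^bsub>V\<^esub>) = \<zero>\<^bsub>K\<^esub> \<odot>\<^bsub>W\<^esub> f \<zero>\<^bsub>V\<^esub>" "f \<zero>\<^bsub>V\<^esub> \<in> carrier W"
    using assms(1) V.R.zero_closed V.M.zero_closed unfolding linear_maps_def by blast+
  then show ?thesis by simp
qed

text \<open>As a function, the structure map of the module of \<open>v\<close> depends only on its target, so it also
  serves as the map induced by an inclusion of a sublevel set of another function \<open>u\<close>.\<close>

lemma induced_module_positive:
  assumes "0 < t"
  shows "pspace (induced_module K u) t = singular_homology K 0 (top_of_set (sublevel u (level_param t)))"
    and "pmap (induced_module K u) t r = homology_map K 0 (top_of_set (sublevel u (level_param r))) id"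
  using assms by (simp_all add: induced_module_def induced_pspace_def level_space_def)

lemma module_induced_module:
  assumes "Ring.field K"
  shows "Module.module K (pspace (induced_module K u) t)"
  using persistence_module_induced_module [OF assms, of u]
  unfolding persistence_module_def by (elim conjE) (rule spec)

text \<open>The inclusion is required only for \<open>0 < s\<close>: otherwise the source is the
  zero space and the map is constantly zero.\<close>

lemma induced_module_inclusion_linear:
  assumes K: "Ring.field K"
    and sub: "0 < s \<Longrightarrow> 0 < t \<and> sublevel u (level_param s) \<subseteq> sublevel v (level_param t)"
  shows "pmap (induced_module K v) s t
    \<in> linear_maps K (pspace (induced_module K u) s) (pspace (induced_module K v) t)"
proof (cases "0 < s")
  case True
  with sub have t: "0 < t" and ST: "sublevel u (level_param s) \<subseteq> sublevel v (level_param t)" by auto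
  have "cring K" using K by (simp add: Ring.field_def domain_def)
  then show ?thesis
    unfolding induced_module_positive [OF True] induced_module_positive(1) [OF t]
    by (rule homology_map_inclusion_linear [OF _ ST])
next
  case False
  let ?V = "pspace (induced_module K v) t"
  have zero: "pmap (induced_module K v) s t = (\<lambda>_. \<zero>\<^bsub>?V\<^esub>)"
    using False by (simp add: induced_module_def)
  interpret V: Module.module K ?V by (rule module_induced_module [OF K])
  show ?thesis unfolding zero linear_maps_def by simp
qed

text \<open>Functoriality of inclusions across three functions; suitable choices of
  \<open>u\<close>, \<open>v\<close>, \<open>w\<close> give both naturality and the interleaving
  identities. For \<open>s \<le> 0\<close> the level \<open>t\<close> may be positive, so the second
  map must be known to preserve zero.\<close>

lemma induced_module_inclusion_comp:
  assumes K: "Ring.field K"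
    and uv: "0 < s \<Longrightarrow> 0 < t \<and> sublevel u (level_param s) \<subseteq> sublevel v (level_param t)"
    and vw: "0 < t \<Longrightarrow> 0 < r \<and> sublevel v (level_param t) \<subseteq> sublevel w (level_param r)"
    and x: "x \<in> carrier (pspace (induced_module K u) s)"
  shows "pmap (induced_module K w) t r (pmap (induced_module K v) s t x)
    = pmap (induced_module K w) s r x"
proof (cases "0 < s")
  case True
  with uv have t: "0 < t" and ST: "sublevel u (level_param s) \<subseteq> sublevel v (level_param t)" by auto
  have TU: "sublevel v (level_param t) \<subseteq> sublevel w (level_param r)" using vw [OF t] by simp
  have "cring K" using K by (simp add: Ring.field_def domain_def)
  then show ?thesis
    using x unfolding induced_module_positive [OF True] induced_module_positive(2) [OF t]
    by (rule homology_map_inclusion_comp [OF _ ST TU])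
next
  case False
  have "pmap (induced_module K w) t r \<zero>\<^bsub>pspace (induced_module K v) t\<^esub>
      = \<zero>\<^bsub>pspace (induced_module K w) r\<^esub>"
    by (rule linear_maps_zero [OF induced_module_inclusion_linear [OF K vw]
        module_induced_module [OF K] module_induced_module [OF K]])
  then show ?thesis using False by (simp add: induced_module_def)
qed

lemma interleaved_induced_modules:
  assumes K: "Ring.field K" and "0 < \<Delta>"
    and uv: "\<And>t. sublevel u (level_param t) \<subseteq> sublevel v (level_param (t + \<Delta>))"
    and vu: "\<And>t. sublevel v (level_param t) \<subseteq> sublevel u (level_param (t + \<Delta>))"
  shows "interleaved K \<Delta> (induced_module K u) (induced_module K v)"
proof -
  have morph: "pers_morphism K (induced_module K u) (pers_shift (induced_module K v) \<Delta>)
      (\<lambda>t. pmap (induced_module K v) t (t + \<Delta>))"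
    if uv: "\<And>t. sublevel u (level_param t) \<subseteq> sublevel v (level_param (t + \<Delta>))" for u v
    unfolding pers_morphism_def pers_shift_def pers_module.simps
  proof (intro conjI allI impI ballI)
    show "pmap (induced_module K v) t (t + \<Delta>)
        \<in> linear_maps K (pspace (induced_module K u) t) (pspace (induced_module K v) (t + \<Delta>))" for t
      by (rule induced_module_inclusion_linear [OF K]) (use uv \<open>0 < \<Delta>\<close> in auto)
  next
    fix s t x assume st: "s \<le> t" and x: "x \<in> carrier (pspace (induced_module K u) s)"
    \<comment> \<open>Both ways around the naturality square equal the map of one inclusion, from
      level \<open>s\<close> of \<open>u\<close> to level \<open>t + \<Delta>\<close> of
      \<open>v\<close>.\<close>
    have "pmap (induced_module K v) t (t + \<Delta>) (pmap (induced_module K u) s t x)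
        = pmap (induced_module K v) s (t + \<Delta>) x"
      by (rule induced_module_inclusion_comp [OF K _ _ x])
        (use st sublevel_param_mono [OF st] uv \<open>0 < \<Delta>\<close> in auto)
    also have "\<dots> = pmap (induced_module K v) (s + \<Delta>) (t + \<Delta>) (pmap (induced_module K v) s (s + \<Delta>) x)"
      by (rule induced_module_inclusion_comp [OF K _ _ x, symmetric])
        (use st sublevel_param_mono [of "s + \<Delta>" "t + \<Delta>" v] uv \<open>0 < \<Delta>\<close> in auto)
    finally show "pmap (induced_module K v) t (t + \<Delta>) (pmap (induced_module K u) s t x) = \<dots>" .
  qed
  have comp: "pmap (induced_module K u) (t + \<Delta>) (t + \<Delta> + \<Delta>) (pmap (induced_module K v) t (t + \<Delta>) x)
      = pmap (induced_module K u) t (t + 2 * \<Delta>) x"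
    if uv: "\<And>t. sublevel u (level_param t) \<subseteq> sublevel v (level_param (t + \<Delta>))"
      and vu: "\<And>t. sublevel v (level_param t) \<subseteq> sublevel u (level_param (t + \<Delta>))"
      and x: "x \<in> carrier (pspace (induced_module K u) t)" for u v t x
  proof -
    have eq: "t + 2 * \<Delta> = t + \<Delta> + \<Delta>" by simp
    show ?thesis
      unfolding eq
      by (rule induced_module_inclusion_comp [OF K _ _ x])
        (use uv [of t] vu [of "t + \<Delta>"] \<open>0 < \<Delta>\<close> in auto)
  qed
  show ?thesis
    unfolding interleaved_def morphism_shift_def shift_morphism_def
    using morph [OF uv] morph [OF vu] comp [OF uv vu] comp [OF vu uv] by blast
qed

theorem corollary4p12:
  fixes K :: "'k ring" and B B' :: "complex \<Rightarrow> complex"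
  assumes "Ring.field K"
    and "blaschke_product B" and "strong_property_B B"
    and "blaschke_product B'" and "strong_property_B B'"
    and "joined_by_sup_norm_path {u. inner_function u \<and> strong_property_B u} B B'"
  shows "interleaving_distance K (induced_module K B) (induced_module K B') < \<infinity>"
proof -
  obtain C where C: "0 < C"
    "\<And>z. z \<in> ball 0 1 \<Longrightarrow> 1 - (cmod (B z))\<^sup>2 \<le> C * (1 - (cmod (B' z))\<^sup>2)"
    "\<And>z. z \<in> ball 0 1 \<Longrightarrow> 1 - (cmod (B' z))\<^sup>2 \<le> C * (1 - (cmod (B z))\<^sup>2)"
    using joined_inner_functions_defect_le [OF assms(6)] by blast
  \<comment> \<open>The summand 1 makes the logarithm positive while \<open>exp \<Delta>\<close>
    still dominates \<open>4 * C\<close>.\<close>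
  define \<Delta> where "\<Delta> = ln (1 + 4 * C)"
  have \<Delta>: "0 < \<Delta>" "4 * C \<le> exp \<Delta>" using C(1) by (auto simp: \<Delta>_def)
  have "interleaved K \<Delta> (induced_module K B) (induced_module K B')"
    by (intro interleaved_induced_modules assms(1) sublevel_param_shift [where C = C] C \<Delta>)
  then have "interleaving_distance K (induced_module K B) (induced_module K B') \<le> ennreal \<Delta>"
    unfolding interleaving_distance_def using \<Delta>(1) by (intro Inf_lower) auto
  also have "\<dots> < \<infinity>" by simp
  finally show ?thesis .
qed

end
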